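(* There is an absolute constant $c>0$ such that the following holds. Let $N\ge5$ be prime. Suppose $\mathbf{s}\in\mathbb{C}^{N^2}$ is a random $K$-sparse vector ($K\ge1$ an integer) with $K\le N/(16\log(N/\varepsilon))$ for some sufficiently small $\varepsilon>0$, where sufficiently small means that $\varepsilon<1$ and there exists $\vartheta\ge1$ with $\sqrt{\vartheta\log N/\log(N/\varepsilon)}\le c$. Suppose further that $\mathbf{H}=\sum_{i=0}^{N^2-1}s_i\mathbf{H}_i\in\mathbb{C}^{N\times N}$ and that $\mathbf{y}=\mathbf{H}\mathbf{f}$ has been observed, where $\mathbf{f}$ is the Alltop sequence of length $N$. Then Basis Pursuit recovers $\mathbf{s}$ from $\mathbf{y}$ (that is, $\mathbf{s}$ is the unique minimizer of $\|\mathbf{s}'\|_1$ over all $\mathbf{s}'\in\mathbb{C}^{N^2}$ with $\mathbf{\Phi}\mathbf{s}'=\mathbf{y}$) with probability greater than $1-2\varepsilon^2-K^{-\vartheta}$ for some $\vartheta\ge1$ such that $\sqrt{\vartheta\log N/\log(N/\varepsilon)}\le c$.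
   Context: Indices of coordinates in $\mathbb{C}^N$ run over $0,\dots,N-1$, $\omega_N=e^{2\pi \mathrm{i}/N}$ with $\mathrm{i}=\sqrt{-1}$, and $\log$ is the natural logarithm. "Absolute constant" means that $c$ does not depend on $N$, $K$, $\varepsilon$ or $\vartheta$. Time-frequency basis: $\mathbf{S}$ is the $N\times N$ cyclic unit-shift matrix, $\mathbf{S}e_j=e_{(j+1)\bmod N}$ on standard basis vectors, and $\mathbf{M}=\mathrm{diag}(\omega_N^0,\omega_N^1,\dots,\omega_N^{N-1})$. For $i=0,\dots,N^2-1$, $\mathbf{H}_i=\mathbf{M}^{\,i \bmod N}\,\mathbf{S}^{\lfloor i/N\rfloor}$. Alltop sequence: $\mathbf{f}=(f_n)_{n=0}^{N-1}$ with $f_n=\frac{1}{\sqrt N}e^{2\pi \mathrm{i} n^3/N}$. Dictionary: $\mathbf{\Phi}\in\mathbb{C}^{N\times N^2}$ is the matrix with columns $\boldsymbol{\varphi}_i=\mathbf{H}_i\mathbf{f}$, $i=0,\dots,N^2-1$, so that $\mathbf{H}\mathbf{f}=\mathbf{\Phi}\mathbf{s}$. Random $K$-sparse vector: the support of $\mathbf{s}$ is a uniformly random $K$-element subset of $\{0,\dots,N^2-1\}$, and, independently of the support, the $K$ nonzero coefficients are independent complex Gaussian variables with mean zero and unit variance (real and imaginary parts independent Gaussians with mean $0$ and variance $1/2$). Probability is with respect to this distribution. Basis Pursuit (BP): solve $\min\|\mathbf{s}'\|_1$ subject to $\mathbf{\Phi}\mathbf{s}'=\mathbf{y}$, where $\|\mathbf{s}'\|_1=\sum_i|s'_i|$.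 *)

theory Defs
  imports
    "HOL-Probability.Probability"
    "HOL-Computational_Algebra.Primes"
    "Jordan_Normal_Form.Matrix"
begin

unbundle no vec_syntax
hide_const (open) Finite_Cartesian_Product.vec Finite_Cartesian_Product.mat

definition root_unity :: "nat \<Rightarrow> complex" where
  "root_unity N = exp (2 * of_real pi * \<i> / of_nat N)"

definition shift_mat :: "nat \<Rightarrow> complex mat" where
  "shift_mat N = mat N N (\<lambda>(i, j). if i = (j + 1) mod N then 1 else 0)"

definition modulation_mat :: "nat \<Rightarrow> complex mat" where
  "modulation_mat N = mat_diag N (\<lambda>j. root_unity N ^ j)"

definition tf_shift :: "nat \<Rightarrow> nat \<Rightarrow> complex mat" where
  "tf_shift N i = modulation_mat N ^\<^sub>m (i mod N) * shift_mat N ^\<^sub>m (i div N)"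

definition alltop :: "nat \<Rightarrow> complex vec" where
  "alltop N = vec N (\<lambda>n. exp (2 * of_real pi * \<i> * of_nat (n ^ 3) / of_nat N) / of_real (sqrt (real N)))"

definition dictionary :: "nat \<Rightarrow> complex mat" where
  "dictionary N = mat_of_cols N (map (\<lambda>i. tf_shift N i *\<^sub>v alltop N) [0..<N\<^sup>2])"

(* The matrix sum of s_i H_i is written entrywise, since dimension-carrying matrices
   do not form an additive monoid on the whole type. *)
definition channel :: "nat \<Rightarrow> complex vec \<Rightarrow> complex mat" where
  "channel N s = mat N N (\<lambda>(a, b). \<Sum>i<N\<^sup>2. s $ i * tf_shift N i $$ (a, b))"

definition l1_norm_vec :: "complex vec \<Rightarrow> real" where
  "l1_norm_vec v = (\<Sum>i<dim_vec v. cmod (v $ i))"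

definition bp_solutions :: "complex mat \<Rightarrow> complex vec \<Rightarrow> complex vec set" where
  "bp_solutions A y =
     {x. is_arg_min l1_norm_vec (\<lambda>x'. x' \<in> carrier_vec (dim_col A) \<and> A *\<^sub>v x' = y) x}"

definition bp_recovers :: "complex mat \<Rightarrow> complex vec \<Rightarrow> complex vec \<Rightarrow> bool" where
  "bp_recovers A y s \<longleftrightarrow> bp_solutions A y = {s}"

(* normal_density takes the standard deviation: real and imaginary parts have variance 1/2. *)
definition complex_gaussian :: "complex measure" where
  "complex_gaussian =
     distr (density lborel (normal_density 0 (sqrt (1/2))) \<Otimes>\<^sub>M
            density lborel (normal_density 0 (sqrt (1/2))))
       borel (\<lambda>(x, y). Complex x y)"

(* A point is a pair (T, g): a uniformly distributed K-subset T of {..<n} and, independently of T,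
   i.i.d. complex Gaussians g i for all i < n. Only the K values g i with i in T enter
   sparse_vec; given T, they are i.i.d. complex Gaussians, almost surely all nonzero. *)
definition sparse_space :: "nat \<Rightarrow> nat \<Rightarrow> (nat set \<times> (nat \<Rightarrow> complex)) measure" where
  "sparse_space n K =
     measure_pmf (pmf_of_set {T. T \<subseteq> {..<n} \<and> card T = K}) \<Otimes>\<^sub>M
     (\<Pi>\<^sub>M i\<in>{..<n}. complex_gaussian)"

definition sparse_vec :: "nat \<Rightarrow> nat set \<times> (nat \<Rightarrow> complex) \<Rightarrow> complex vec" where
  "sparse_vec n = (\<lambda>(T, g). vec n (\<lambda>i. if i \<in> T then g i else 0))"

end

theory Submission
  imports Defs
begin

text \<open>
  Write \<open>H = \<Phi>\<^sup>*\<Phi> - 1\<close> and let \<open>H\<^sub>T\<close> be its compression to an index set \<open>T\<close> of size \<open>K\<close>. If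
  \<open>\<parallel>H\<^sub>T\<parallel> \<le> 1/2\<close>, then for \<open>j \<notin> T\<close> the dual certificate has the entry \<open>\<langle>a, sgn s\<rangle>\<close> with
  \<open>\<parallel>a\<parallel>\<^sup>2 \<le> 4K/N\<close>, since quadratic Gauss sums bound the coherence by \<open>1/\<surd>N\<close>; Hoeffding's inequality
  for the independent random signs makes all these entries smaller than 1 with large probability.

  The bound on \<open>\<parallel>H\<^sub>T\<parallel>\<close> comes from the moments of \<open>Tr H\<^sub>T\<^sup>2\<^sup>p\<close> with \<open>p\<close> of order \<open>log N\<close>, by induction
  on the size of \<open>T\<close>. Removing \<open>j\<close> from \<open>T\<close> and expanding the diagonal entry of \<open>H\<^sub>T\<^sup>2\<^sup>p\<close> at \<open>j\<close> along first
  returns bounds it by \<open>3\<parallel>H\<^sub>T\<^sub>'\<^sup>p\<^sup>-\<^sup>1 b\<^sub>j\<parallel>\<^sup>2\<close> plus a small error, where \<open>T' = T - {j}\<close> and \<open>b\<^sub>j\<close> is the \<open>j\<close>-th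
  column of \<open>H\<close>. Averaging over \<open>j\<close>, the tight frame identity \<open>\<Phi>\<Phi>\<^sup>* = N\<close> turns this into a
  multiple of \<open>K/N\<close> times lower moments for \<open>T'\<close>.

  The constant may be taken to be \<open>c = 1/10\<close>, and \<open>\<theta> = 1\<close> always works.
\<close>

section \<open>Powers of a hermitian kernel\<close>

text \<open>Vectors are functions on the whole index type and only the sum is cut to
  \<open>T\<close>. On \<open>T\<close> this is the compression of \<open>H\<close>; at indices
  outside \<open>T\<close> it gives the correlations with the remaining columns, from which the dual
  certificate is read off.\<close>

definition kernel_app :: "('i \<Rightarrow> 'i \<Rightarrow> complex) \<Rightarrow> 'i set \<Rightarrow> ('i \<Rightarrow> complex) \<Rightarrow> 'i \<Rightarrow> complex" where
  "kernel_app H T v = (\<lambda>i. \<Sum>k\<in>T. H i k * v k)"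

definition cip :: "'i set \<Rightarrow> ('i \<Rightarrow> complex) \<Rightarrow> ('i \<Rightarrow> complex) \<Rightarrow> complex" where
  "cip T u v = (\<Sum>i\<in>T. cnj (u i) * v i)"

definition cnorm :: "'i set \<Rightarrow> ('i \<Rightarrow> complex) \<Rightarrow> real" where
  "cnorm T v = L2_set (\<lambda>i. cmod (v i)) T"

definition unit_fun :: "'i \<Rightarrow> 'i \<Rightarrow> complex" where
  "unit_fun j = (\<lambda>i. if i = j then 1 else 0)"

lemma cnorm_nonneg [simp]: "0 \<le> cnorm T v"
  by (simp add: cnorm_def)

lemma cnorm_sq: "(cnorm T v)\<^sup>2 = (\<Sum>i\<in>T. (cmod (v i))\<^sup>2)"
  by (simp add: cnorm_def L2_set_def sum_nonneg)

lemma cip_self: "cip T v v = complex_of_real ((cnorm T v)\<^sup>2)"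
  unfolding cnorm_sq cip_def of_real_sum
  by (intro sum.cong) (auto simp: complex_norm_square mult.commute simp flip: of_real_power)

lemma cip_cauchy_schwarz: "cmod (cip T u v) \<le> cnorm T u * cnorm T v"
proof -
  have "cmod (cip T u v) \<le> (\<Sum>i\<in>T. \<bar>cmod (u i)\<bar> * \<bar>cmod (v i)\<bar>)"
    unfolding cip_def by (rule order_trans[OF norm_sum]) (simp add: norm_mult)
  also have "\<dots> \<le> cnorm T u * cnorm T v"
    unfolding cnorm_def by (rule L2_set_mult_ineq)
  finally show ?thesis .
qed

lemma cip_add_right: "cip T u (\<lambda>i. v i + w i) = cip T u v + cip T u w"
  by (simp add: cip_def distrib_left sum.distrib)

lemma cip_cnj: "cip T u v = cnj (cip T v u)"
  by (simp add: cip_def mult.commute)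

lemma cip_unit: "finite T \<Longrightarrow> j \<in> T \<Longrightarrow> cip T (unit_fun j) v = v j"
  unfolding cip_def unit_fun_def by (subst sum.remove[of _ j]) (auto intro!: sum.neutral)

lemma cnorm_le_add: "cnorm T (\<lambda>i. u i + v i) \<le> cnorm T u + cnorm T v"
proof -
  have "cnorm T (\<lambda>i. u i + v i) \<le> L2_set (\<lambda>i. cmod (u i) + cmod (v i)) T"
    unfolding cnorm_def by (rule L2_set_mono) (auto intro: norm_triangle_ineq)
  also have "\<dots> \<le> cnorm T u + cnorm T v"
    unfolding cnorm_def by (rule L2_set_triangle_ineq)
  finally show ?thesis .
qed

lemma norm_le_cnorm: "finite T \<Longrightarrow> i \<in> T \<Longrightarrow> cmod (v i) \<le> cnorm T v"
  unfolding cnorm_def by (rule member_le_L2_set)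

lemma cnorm_uminus [simp]: "cnorm T (\<lambda>i. - v i) = cnorm T v"
  by (simp add: cnorm_def)

section \<open>Log-convex sequences and renewal equations\<close>

text \<open>The logarithm of \<open>l\<close> is convex, so its chord slopes from index 0 increase,
  and \<open>w\<close> is the exponential of the slope at \<open>q\<close>. Equality at
  \<open>q\<close> lets an estimate in terms of \<open>w\<close> be read back as one in terms of
  \<open>l q\<close>.\<close>

lemma log_convex_geometric_bound:
  fixes l :: "nat \<Rightarrow> real"
  assumes nn: "\<And>i. 0 \<le> l i" and lc: "\<And>i. (l (Suc i))\<^sup>2 \<le> l i * l (Suc (Suc i))"
  shows "\<exists>w\<ge>0. l q = l 0 * w ^ q \<and> (\<forall>i\<le>q. l i \<le> l 0 * w ^ i)"
proof (cases "l q = 0 \<or> q = 0")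
  case True
  show ?thesis
  proof (cases "q = 0")
    case True
    then show ?thesis by (intro exI[of _ 0]) auto
  next
    case False
    with True have "l q = 0" by simp
    \<comment> \<open>A zero spreads downwards to index 1, though not to index 0, so
      \<open>w = 0\<close> serves here.\<close>
    have down: "l i = 0" if "l (Suc i) = 0" "i > 0" for i
      using lc[of "i - 1"] that by simp
    have "l (q - i) = 0" if "i < q" for i
      using that
    proof (induction i)
      case (Suc i)
      then show ?case using down[of "q - Suc i"] by (simp add: Suc_diff_Suc)
    qed (use \<open>l q = 0\<close> in simp)
    then have z: "l i = 0" if "0 < i" "i \<le> q" for i
      using that by (metis diff_diff_cancel diff_less less_le_trans)
    show ?thesis
    proof (intro exI[of _ 0] conjI allI impI)
      fix i assume "i \<le> q" then show "l i \<le> l 0 * 0 ^ i" using z[of i] by (cases i) auto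
    qed (use \<open>l q = 0\<close> False in auto)
  qed
next
  case False
  then have q: "q > 0" by simp
  have lq: "l q > 0" using nn[of q] False by linarith
  \<comment> \<open>A zero would also spread upwards to \<open>q\<close>; hence all terms up to
    \<open>q\<close> are positive and have logarithms.\<close>
  have up: "l (Suc i) = 0" if "l i = 0" for i
    using lc[of i] that by simp
  have pos: "l i > 0" if "i \<le> q" for i
  proof (rule ccontr)
    assume "\<not> l i > 0"
    then have "l i = 0" using nn[of i] by auto
    then have "l (i + k) = 0" for k by (induction k) (use up in auto)
    from this[of "q - i"] that lq show False by simp
  qed
  define f where "f i = ln (l i) - ln (l 0)" for i
  have f0: "f 0 = 0" by (simp add: f_def)
  have f2: "2 * f (Suc i) \<le> f i + f (Suc (Suc i))" if "Suc (Suc i) \<le> q" for i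
  proof -
    have "ln ((l (Suc i))\<^sup>2) \<le> ln (l i * l (Suc (Suc i)))"
      using lc[of i] pos[of "Suc i"] that by (intro iffD2[OF ln_le_cancel_iff]) (auto intro!: mult_pos_pos pos)
    then show ?thesis using that pos[of i] pos[of "Suc (Suc i)"] pos[of "Suc i"]
      by (simp add: f_def ln_mult ln_realpow)
  qed
  \<comment> \<open>Monotonicity of the chord slopes f(i)/i with denominators cleared, starting from
    \<open>f 0 = 0\<close>.\<close>
  have step: "real (Suc i) * f i \<le> real i * f (Suc i)" if "Suc i \<le> q" for i
    using that
  proof (induction i)
    case (Suc i)
    have "real (Suc i) * (2 * f (Suc i)) \<le> real (Suc i) * (f i + f (Suc (Suc i)))"
      using f2[of i] Suc.prems by (intro mult_left_mono) auto
    with Suc show ?case by (simp add: algebra_simps)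
  qed (simp add: f0)
  have mono: "f i / real i \<le> f (i + k) / real (i + k)" if "0 < i" "i + k \<le> q" for i k
    using that
  proof (induction k)
    case (Suc k)
    have "f (i + k) / real (i + k) \<le> f (Suc (i + k)) / real (Suc (i + k))"
      using step[of "i + k"] Suc.prems by (simp add: field_simps)
    with Suc show ?case by simp
  qed simp
  define w where "w = exp (f q / real q)"
  have wi: "w ^ i = exp (real i * (f q / real q))" for i
    unfolding w_def by (rule exp_of_nat_mult[symmetric])
  have li: "l i = l 0 * exp (f i)" if "i \<le> q" for i
    using pos[of i] pos[of 0] that by (simp add: f_def exp_diff)
  show ?thesis
  proof (intro exI[of _ w] conjI allI impI)
    show "l q = l 0 * w ^ q" using li[of q] q by (simp add: wi)
    fix i assume i: "i \<le> q"
    show "l i \<le> l 0 * w ^ i"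
    proof (cases "i = 0")
      case False
      then have "f i \<le> real i * (f q / real q)"
        using mono[of i "q - i"] i by (simp add: field_simps)
      then show ?thesis using li[OF i] nn[of 0] by (simp add: wi mult_left_mono)
    qed simp
  qed (simp add: w_def)
qed

text \<open>Induction with the ansatz \<open>a * \<rho> ^ m\<close>. The convolution of the two
  geometric sequences is a difference quotient with denominator \<open>\<rho> - w\<close>, which the
  hypothesis \<open>a \<le> \<rho> * (\<rho> - w)\<close> absorbs.\<close>

lemma renewal_bound:
  fixes U y :: "nat \<Rightarrow> complex" and a w \<rho> :: real
  assumes U0: "U 0 = 1" and U1: "U 1 = 0"
    and rec: "\<And>m. U (Suc (Suc m)) = (\<Sum>s\<le>m. U (m - s) * y s)"
    and y: "\<And>s. s \<le> n \<Longrightarrow> cmod (y s) \<le> a * w ^ s"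
    and w: "0 \<le> w" "w \<le> \<rho>" and a: "0 \<le> a" "a \<le> \<rho> * (\<rho> - w)"
  shows "m \<le> n \<Longrightarrow> cmod (U (Suc (Suc m))) \<le> a * \<rho> ^ m"
proof (induction m rule: less_induct)
  case (less m)
  have \<rho>: "0 \<le> \<rho>" using w by simp
  show ?case
  proof (cases m)
    case 0
    then show ?thesis using y[of 0] by (simp add: rec U0)
  next
    case (Suc m')
    have "cmod (U (Suc (Suc m))) \<le> (\<Sum>s\<le>m. cmod (U (m - s)) * (a * w ^ s))"
      unfolding rec by (rule order_trans[OF norm_sum], rule sum_mono)
        (use less.prems y in \<open>auto simp: norm_mult intro!: mult_left_mono\<close>)
    \<comment> \<open>The last two summands are special: \<open>U 1 = 0\<close> removes one, and
      \<open>U 0 = 1\<close> leaves \<open>a * w ^ m\<close>.\<close>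
    also have "\<dots> = (\<Sum>s<m'. cmod (U (m - s)) * (a * w ^ s)) + a * w ^ m"
      by (simp add: Suc U1 U0 lessThan_Suc_atMost[symmetric] U1[simplified])
    also have "(\<Sum>s<m'. cmod (U (m - s)) * (a * w ^ s)) \<le> (\<Sum>s<m'. a * \<rho> ^ (m' - Suc s) * (a * w ^ s))"
    proof (rule sum_mono, rule mult_right_mono)
      fix s assume "s \<in> {..<m'}"
      then have s: "s < m'" by simp
      then have *: "m - s = Suc (Suc (m' - Suc s))" using Suc by simp
      show "cmod (U (m - s)) \<le> a * \<rho> ^ (m' - Suc s)"
        unfolding * by (rule less.IH) (use s Suc less.prems in auto)
    qed (use a w in auto)
    also have "\<dots> = a * (a * (\<Sum>s<m'. \<rho> ^ (m' - Suc s) * w ^ s))"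
      by (simp add: sum_distrib_left mult_ac)
    also have "\<dots> \<le> a * (\<rho> * (\<rho> - w) * (\<Sum>s<m'. \<rho> ^ (m' - Suc s) * w ^ s))"
      using a w \<rho> by (intro mult_left_mono mult_right_mono sum_nonneg) auto
    also have "\<rho> * (\<rho> - w) * (\<Sum>s<m'. \<rho> ^ (m' - Suc s) * w ^ s) = \<rho> * (\<rho> ^ m' - w ^ m')"
    proof -
      have "(\<Sum>s<m'. \<rho> ^ (m' - Suc s) * w ^ s) = (\<Sum>s<m'. w ^ (m' - Suc s) * \<rho> ^ s)"
        by (subst sum.nat_diff_reindex[symmetric]) (auto intro!: sum.cong simp: Suc_diff_Suc)
      then show ?thesis
        using power_diff_sumr2[of \<rho> m' w] by (simp add: mult.assoc)
    qed
    also have "a * (\<rho> * (\<rho> ^ m' - w ^ m')) + a * w ^ m \<le> a * \<rho> ^ m"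
    proof -
      have "w * w ^ m' \<le> \<rho> * w ^ m'" using w by (intro mult_right_mono) auto
      then have "\<rho> * (\<rho> ^ m' - w ^ m') + w ^ m \<le> \<rho> ^ m" by (simp add: Suc algebra_simps)
      then have "a * (\<rho> * (\<rho> ^ m' - w ^ m') + w ^ m) \<le> a * \<rho> ^ m"
        using a by (intro mult_left_mono) auto
      then show ?thesis by (simp add: algebra_simps)
    qed
    finally show ?thesis by simp
  qed
qed

section \<open>Hermitian kernels with zero diagonal and their even traces\<close>

locale hermitian_kernel =
  fixes H :: "'i \<Rightarrow> 'i \<Rightarrow> complex"
  assumes herm: "\<And>i j. H j i = cnj (H i j)"
    and diag: "\<And>i. H i i = 0"
begin

abbreviation pw :: "'i set \<Rightarrow> nat \<Rightarrow> ('i \<Rightarrow> complex) \<Rightarrow> 'i \<Rightarrow> complex" where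
  "pw T m \<equiv> (kernel_app H T) ^^ m"

text \<open>This is Tr H_T^(2p), written as the squared Frobenius norm of H_T^p, so that it is
  visibly nonnegative.\<close>

definition even_trace :: "'i set \<Rightarrow> nat \<Rightarrow> real" where
  "even_trace T p = (\<Sum>j\<in>T. (cnorm T (pw T p (unit_fun j)))\<^sup>2)"

lemma cip_app: "cip T u (kernel_app H T v) = cip T (kernel_app H T u) v"
proof -
  have "cip T u (kernel_app H T v) = (\<Sum>i\<in>T. \<Sum>k\<in>T. cnj (u i) * (H i k * v k))"
    by (simp add: cip_def kernel_app_def sum_distrib_left)
  also have "\<dots> = (\<Sum>k\<in>T. \<Sum>i\<in>T. cnj (u i) * (H i k * v k))" by (rule sum.swap)
  also have "\<dots> = cip T (kernel_app H T u) v"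
    by (auto simp: cip_def kernel_app_def sum_distrib_right sum_distrib_left herm[symmetric] mult_ac intro!: sum.cong)
  finally show ?thesis .
qed

lemma cip_pw: "cip T u (pw T m v) = cip T (pw T m u) v"
proof (induction m arbitrary: u)
  case (Suc m)
  have "cip T u (pw T (Suc m) v) = cip T (pw T m (kernel_app H T u)) v"
    by (simp add: cip_app Suc.IH)
  then show ?case by (simp add: funpow_swap1)
qed simp

lemma cip_pw_pw: "cip T (pw T i u) (pw T j v) = cip T u (pw T (i + j) v)"
  by (simp add: cip_pw[symmetric] funpow_add)

text \<open>Moving one factor of the self-adjoint \<open>H\<close> across the inner product turns
  the square into <H^i v, H^(i+2) v>, and Cauchy-Schwarz applies.\<close>

lemma cnorm_pw_log_convex:
  "(cnorm T (pw T (Suc i) v))\<^sup>2 \<le> cnorm T (pw T i v) * cnorm T (pw T (Suc (Suc i)) v)"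
proof -
  have "complex_of_real ((cnorm T (pw T (Suc i) v))\<^sup>2) = cip T (pw T i v) (pw T (Suc (Suc i)) v)"
    unfolding cip_self[symmetric] cip_pw_pw by simp
  then have "(cnorm T (pw T (Suc i) v))\<^sup>2 = cmod (cip T (pw T i v) (pw T (Suc (Suc i)) v))"
    by (metis norm_of_real abs_of_nonneg zero_le_power2)
  then show ?thesis using cip_cauchy_schwarz by metis
qed

lemma cnorm_pw_geometric:
  "\<exists>w\<ge>0. cnorm T (pw T q v) = cnorm T v * w ^ q \<and> (\<forall>i\<le>q. cnorm T (pw T i v) \<le> cnorm T v * w ^ i)"
  using log_convex_geometric_bound[of "\<lambda>i. cnorm T (pw T i v)" q] cnorm_pw_log_convex by simp

text \<open>The operator norm of H_T^p is at most its Frobenius norm: each entry of H_T^p v is the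
  inner product of a column of H_T^p with v.\<close>

lemma cnorm_pw_le_even_trace:
  assumes "finite T"
  shows "(cnorm T (pw T p v))\<^sup>2 \<le> even_trace T p * (cnorm T v)\<^sup>2"
proof -
  have "(cmod (pw T p v i))\<^sup>2 \<le> (cnorm T (pw T p (unit_fun i)))\<^sup>2 * (cnorm T v)\<^sup>2" if "i \<in> T" for i
  proof -
    have "pw T p v i = cip T (pw T p (unit_fun i)) v"
      by (simp add: cip_pw[symmetric] cip_unit assms that)
    then have "cmod (pw T p v i) \<le> cnorm T (pw T p (unit_fun i)) * cnorm T v"
      by (simp add: cip_cauchy_schwarz)
    then have "(cmod (pw T p v i))\<^sup>2 \<le> (cnorm T (pw T p (unit_fun i)) * cnorm T v)\<^sup>2"
      by (rule power_mono) simp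
    then show ?thesis by (simp add: power_mult_distrib)
  qed
  then show ?thesis
    unfolding cnorm_sq[of T "pw T p v"] even_trace_def sum_distrib_right by (rule sum_mono)
qed

text \<open>The trace controls the power \<open>p\<close>, and log-convexity descends from there to
  the first power, in place of the spectral theorem. The threshold (1/4)^p corresponds to norm
  1/2.\<close>

lemma contraction_of_even_trace:
  assumes "finite T" and tr: "even_trace T p < (1/4) ^ p" and p: "p > 0"
  shows "cnorm T (kernel_app H T v) \<le> cnorm T v / 2"
proof (cases "cnorm T v = 0")
  case True
  have "(cnorm T (pw T 1 v))\<^sup>2 \<le> 0" using cnorm_pw_log_convex[of T 0 v] True by simp
  then show ?thesis using True by simp
next
  case False
  then have pos: "cnorm T v > 0" using cnorm_nonneg[of T v] by linarith
  obtain w where w: "w \<ge> 0" "cnorm T (pw T p v) = cnorm T v * w ^ p"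
    "\<forall>i\<le>p. cnorm T (pw T i v) \<le> cnorm T v * w ^ i"
    using cnorm_pw_geometric by blast
  have "(cnorm T v)\<^sup>2 * (w\<^sup>2) ^ p \<le> even_trace T p * (cnorm T v)\<^sup>2"
    using cnorm_pw_le_even_trace[OF assms(1), of p v] unfolding w(2)
    by (simp add: power_mult_distrib power_mult[symmetric] mult.commute)
  then have "(w\<^sup>2) ^ p \<le> even_trace T p" using pos by (simp add: mult.commute)
  also note tr
  finally have "w\<^sup>2 < 1/4" by (rule power_less_imp_less_base) simp
  also have "1/4 = (1/2 :: real)\<^sup>2" by (simp add: power2_eq_square)
  finally have "w < 1/2" by (rule power_less_imp_less_base) simp
  moreover have "cnorm T (kernel_app H T v) \<le> cnorm T v * w" using w(3)[rule_format, of 1] p by simp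
  moreover have "cnorm T v * w \<le> cnorm T v * (1/2)" using \<open>w < 1/2\<close> pos by (intro mult_left_mono) auto
  ultimately show ?thesis by simp
qed

section \<open>Adjoining one index to a set\<close>

context
  fixes T :: "'i set" and j :: 'i
  assumes fin: "finite T" and j: "j \<notin> T"
begin

text \<open>Walks that start at \<open>j\<close> and end elsewhere are cut at their last visit to
  \<open>j\<close>: it is followed by one step along the column of \<open>j\<close> and then by
  \<open>s\<close> steps that avoid \<open>j\<close>.\<close>

lemma pw_insert_off:
  assumes "i \<noteq> j"
  shows "pw (insert j T) m (unit_fun j) i
    = (\<Sum>s<m. pw (insert j T) (m - Suc s) (unit_fun j) j * pw T s (\<lambda>i. H i j) i)"
  using assms
proof (induction m arbitrary: i)
  case 0
  then show ?case by (simp add: unit_fun_def)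
next
  case (Suc m)
  let ?W = "\<lambda>m. pw (insert j T) m (unit_fun j)"
  let ?b = "\<lambda>i. H i j"
  have "?W (Suc m) i = H i j * ?W m j + (\<Sum>k\<in>T. H i k * ?W m k)"
    using fin j by (simp add: kernel_app_def)
  also have "(\<Sum>k\<in>T. H i k * ?W m k) = (\<Sum>k\<in>T. H i k * (\<Sum>s<m. ?W (m - Suc s) j * pw T s ?b k))"
    using j by (intro sum.cong refl arg_cong2[of _ _ _ _ "(*)"] Suc.IH) auto
  also have "\<dots> = (\<Sum>s<m. ?W (m - Suc s) j * (\<Sum>k\<in>T. H i k * pw T s ?b k))"
    unfolding sum_distrib_left by (subst sum.swap) (simp add: mult_ac)
  also have "\<dots> = (\<Sum>s<m. ?W (m - Suc s) j * pw T (Suc s) ?b i)"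
    by (simp add: kernel_app_def)
  finally show ?case
    by (simp add: sum.lessThan_Suc_shift del: funpow.simps(2) sum.lessThan_Suc)
qed

text \<open>A closed walk at \<open>j\<close> is cut at its last earlier visit to \<open>j\<close>.
  The final excursion takes \<open>s + 2\<close> steps and has weight <b, H_T^s b>; a return in one
  step has weight \<open>H j j = 0\<close>.\<close>

lemma pw_insert_diag:
  "pw (insert j T) (Suc (Suc m)) (unit_fun j) j
    = (\<Sum>s\<le>m. pw (insert j T) (m - s) (unit_fun j) j * cip T (\<lambda>i. H i j) (pw T s (\<lambda>i. H i j)))"
proof -
  let ?W = "\<lambda>m. pw (insert j T) m (unit_fun j)"
  let ?b = "\<lambda>i. H i j"
  have "?W (Suc (Suc m)) j = (\<Sum>k\<in>T. H j k * ?W (Suc m) k)"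
    using fin j by (simp add: kernel_app_def[of _ "insert j T" "kernel_app H (insert j T) _"] diag)
  also have "\<dots> = (\<Sum>k\<in>T. cnj (H k j) * (\<Sum>s\<le>m. ?W (m - s) j * pw T s ?b k))"
    using j by (intro sum.cong refl arg_cong2[of _ _ _ _ "(*)"] herm)
       (subst pw_insert_off, auto simp: lessThan_Suc_atMost)
  also have "\<dots> = (\<Sum>s\<le>m. ?W (m - s) j * cip T ?b (pw T s ?b))"
    unfolding sum_distrib_left cip_def by (subst sum.swap) (simp add: mult_ac)
  finally show ?thesis .
qed

text \<open>Here the diagonal entry of a power is expanded along first returns to \<open>j\<close>. The log-convexity of
  \<open>m \<mapsto> \<parallel>H\<^sup>m b\<parallel>\<close> turns the resulting renewal equation into a scalar one.\<close>
lemma cnorm_pw_insert: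
  "(cnorm (insert j T) (pw (insert j T) (Suc q) (unit_fun j)))\<^sup>2
    \<le> 3 * (cnorm T (pw T q (\<lambda>i. H i j)))\<^sup>2
      + (cnorm T (\<lambda>i. H i j))\<^sup>2 * (8 * real q * (cnorm T (\<lambda>i. H i j))\<^sup>2) ^ q"
proof -
  let ?b = "\<lambda>i. H i j"
  define U where "U m = pw (insert j T) m (unit_fun j) j" for m
  define y where "y s = cip T ?b (pw T s ?b)" for s
  define a where "a = (cnorm T ?b)\<^sup>2"
  \<comment> \<open>Self-adjointness makes the squared norm of column \<open>j\<close> the diagonal
    entry at \<open>j\<close> of the power 2q + 2, to which the renewal equation applies.\<close>
  have "complex_of_real ((cnorm (insert j T) (pw (insert j T) (Suc q) (unit_fun j)))\<^sup>2)
    = cip (insert j T) (unit_fun j) (pw (insert j T) (Suc q + Suc q) (unit_fun j))"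
    unfolding cip_self[symmetric] cip_pw_pw ..
  also have "\<dots> = U (Suc (Suc (2 * q)))"
    using fin by (simp add: cip_unit U_def mult_2 del: funpow.simps(2))
  finally have lhs: "(cnorm (insert j T) (pw (insert j T) (Suc q) (unit_fun j)))\<^sup>2
      = cmod (U (Suc (Suc (2 * q))))"
    by (metis norm_of_real abs_of_nonneg zero_le_power2)
  have a0: "a \<ge> 0" by (simp add: a_def)
  have U0: "U 0 = 1" by (simp add: U_def unit_fun_def)
  have U1: "U 1 = 0" using fin j
    by (simp add: U_def kernel_app_def diag) (auto simp: unit_fun_def intro!: sum.neutral)
  have rec: "U (Suc (Suc m)) = (\<Sum>s\<le>m. U (m - s) * y s)" for m
    unfolding U_def y_def by (rule pw_insert_diag)
  obtain w where w: "w \<ge> 0" "cnorm T (pw T q ?b) = cnorm T ?b * w ^ q"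
    "\<And>i. i \<le> q \<Longrightarrow> cnorm T (pw T i ?b) \<le> cnorm T ?b * w ^ i"
    using cnorm_pw_geometric by blast
  \<comment> \<open>Splitting \<open>s\<close> into two nearly equal halves keeps both exponents at
    most \<open>q\<close>, where the geometric bound is available.\<close>
  have y: "cmod (y s) \<le> a * w ^ s" if "s \<le> 2 * q" for s
  proof -
    have "cmod (y s) = cmod (cip T (pw T (s div 2) ?b) (pw T (s - s div 2) ?b))"
      unfolding y_def cip_pw_pw by simp
    also have "\<dots> \<le> cnorm T (pw T (s div 2) ?b) * cnorm T (pw T (s - s div 2) ?b)"
      by (rule cip_cauchy_schwarz)
    also have "\<dots> \<le> (cnorm T ?b * w ^ (s div 2)) * (cnorm T ?b * w ^ (s - s div 2))"
      using that w by (intro mult_mono w(3)) auto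
    also have "\<dots> = a * w ^ (s div 2 + (s - s div 2))"
      unfolding a_def power_add by (simp add: power2_eq_square)
    finally show ?thesis by simp
  qed
  have target: "cmod (U (Suc (Suc (2 * q)))) \<le> 3 * (a * w ^ (2 * q)) + a * (8 * real q * a) ^ q"
  proof (cases "q = 0")
    case True
    then show ?thesis using rec[of 0] y[of 0] a0 by (simp add: U0)
  next
    case False
    then have q: "real q \<ge> 1" by simp
    note bound = renewal_bound[of U y "2 * q" a w _ "2 * q", OF U0 U1 rec y w(1) _ a0]
    show ?thesis
    proof (cases "2 * real q * a \<le> w\<^sup>2")
      case True
      \<comment> \<open>For large \<open>w\<close>, inflating it by the factor 1 + 1/(2q) leaves
        room for \<open>a\<close> and costs at most e, hence at most 3, over 2q factors: this is the
        main term.\<close>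
      define \<rho> where "\<rho> = w * (1 + 1 / (2 * real q))"
      have \<rho>: "w \<le> \<rho>" using w(1) q by (simp add: \<rho>_def distrib_left)
      have "a \<le> w\<^sup>2 / (2 * real q)" using True q by (simp add: field_simps)
      also have "\<dots> = w * (\<rho> - w)" by (simp add: \<rho>_def power2_eq_square distrib_left)
      also have "\<dots> \<le> \<rho> * (\<rho> - w)" using \<rho> by (intro mult_right_mono) auto
      finally have "cmod (U (Suc (Suc (2 * q)))) \<le> a * \<rho> ^ (2 * q)"
        using \<rho> by (intro bound) auto
      also have "\<dots> = a * w ^ (2 * q) * (1 + 1 / real (2 * q)) ^ (2 * q)"
        by (simp add: \<rho>_def power_mult_distrib)
      also have "\<dots> \<le> a * w ^ (2 * q) * 3"
      proof (rule mult_left_mono)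
        have "(1 + 1 / real (2 * q)) ^ (2 * q) \<le> exp (1 / real (2 * q)) ^ (2 * q)"
          by (intro power_mono) auto
        also have "\<dots> = exp 1" unfolding exp_of_nat_mult[symmetric] using False by simp
        finally show "(1 + 1 / real (2 * q)) ^ (2 * q) \<le> 3" using exp_le by linarith
      qed (use a0 w in auto)
      also have "\<dots> \<le> 3 * (a * w ^ (2 * q)) + a * (8 * real q * a) ^ q" using a0 by simp
      finally show ?thesis .
    next
      case False
      \<comment> \<open>For small \<open>w\<close>, the rate 2t depends on \<open>a\<close> and
        \<open>q\<close> alone, and (2t)^(2q) = (8qa)^q is the error term.\<close>
      define t where "t = sqrt (2 * real q * a)"
      have t0: "0 \<le> t" using a0 by (simp add: t_def)
      have t2: "t\<^sup>2 = 2 * real q * a" using a0 by (simp add: t_def)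
      have wt: "w \<le> t" using False unfolding t2[symmetric]
        by (meson not_le_imp_less less_imp_le power2_le_imp_le t0)
      have "1 * a \<le> real q * a" using q a0 by (intro mult_right_mono)
      then have "a \<le> 2 * t * t" using a0 t2 by (simp add: power2_eq_square)
      also have "\<dots> \<le> 2 * t * (2 * t - w)" using wt t0 by (intro mult_left_mono) auto
      finally have "cmod (U (Suc (Suc (2 * q)))) \<le> a * (2 * t) ^ (2 * q)"
        using wt t0 by (intro bound) auto
      also have "(2 * t) ^ (2 * q) = (8 * real q * a) ^ q"
        unfolding power_mult by (simp add: power_mult_distrib t2)
      also have "a * (8 * real q * a) ^ q \<le> 3 * (a * w ^ (2 * q)) + a * (8 * real q * a) ^ q"
        using a0 w by simp
      finally show ?thesis .
    qed
  qed
  have "a * w ^ (2 * q) = (cnorm T (pw T q ?b))\<^sup>2"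
    unfolding w(2) a_def by (simp add: power_mult_distrib power_mult[symmetric] mult.commute)
  with target show ?thesis unfolding lhs a_def by simp
qed

end

end

section \<open>Moments over random index sets\<close>

text \<open>Double counting through the bijection from (T, j) to (T - {j}, j). It turns a sum over
  (k+1)-sets with one index removed into a sum over k-sets with a free outside index.\<close>

lemma sum_subsets_remove:
  fixes F :: "'i set \<Rightarrow> 'i \<Rightarrow> 'b::comm_monoid_add"
  assumes "finite I"
  shows "(\<Sum>T | T \<subseteq> I \<and> card T = Suc k. \<Sum>j\<in>T. F (T - {j}) j)
       = (\<Sum>T | T \<subseteq> I \<and> card T = k. \<Sum>j\<in>I - T. F T j)"
proof -
  have fin: "finite {T. T \<subseteq> I \<and> card T = m}" for m using assms by simp
  have finT: "finite T" if "T \<subseteq> I" for T using assms that by (rule finite_subset[rotated])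
  have "(\<Sum>T | T \<subseteq> I \<and> card T = Suc k. \<Sum>j\<in>T. F (T - {j}) j)
      = (\<Sum>(T, j)\<in>(SIGMA T:{T. T \<subseteq> I \<and> card T = Suc k}. T). F (T - {j}) j)"
    using fin finT by (intro sum.Sigma) auto
  also have "\<dots> = (\<Sum>(T, j)\<in>(SIGMA T:{T. T \<subseteq> I \<and> card T = k}. I - T). F T j)"
    using finT by (intro sum.reindex_bij_witness[where i = "\<lambda>(T, j). (insert j T, j)" and j = "\<lambda>(T, j). (T - {j}, j)"])
      (auto simp: insert_absorb)
  also have "\<dots> = (\<Sum>T | T \<subseteq> I \<and> card T = k. \<Sum>j\<in>I - T. F T j)"
    using fin assms by (intro sum.Sigma[symmetric]) auto
  finally show ?thesis .
qed

lemma card_subsets_Suc: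
  assumes "finite I"
  shows "Suc k * card {T. T \<subseteq> I \<and> card T = Suc k} = card {T. T \<subseteq> I \<and> card T = k} * (card I - k)"
proof -
  have "(\<Sum>T | T \<subseteq> I \<and> card T = k. \<Sum>j\<in>I - T. 1::nat) = (\<Sum>T | T \<subseteq> I \<and> card T = k. card I - k)"
    using assms by (intro sum.cong) (auto simp: card_Diff_subset finite_subset)
  with sum_subsets_remove[OF assms, of "\<lambda>_ _. 1::nat" k] show ?thesis by (simp add: mult.commute)
qed

text \<open>\<open>frame\<close> is the tight frame identity expressed on coefficients: if y
  combines the columns in \<open>T\<close> with weights \<open>x\<close>, it says that the |<y,
  phi_j>|^2 sum to N |y|^2. Adding \<open>unit_fun\<close> restores the diagonal of the Gram
  matrix.\<close>

locale gram_kernel = hermitian_kernel H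
  for H :: "'i \<Rightarrow> 'i \<Rightarrow> complex" +
  fixes I :: "'i set" and N :: nat
  assumes finI: "finite I" and N_pos: "N > 0" and cardI: "card I = N\<^sup>2"
    and coherence: "\<And>i j. i \<in> I \<Longrightarrow> j \<in> I \<Longrightarrow> (cmod (H i j))\<^sup>2 \<le> 1 / real N"
    and frame: "\<And>T x. T \<subseteq> I \<Longrightarrow> (\<Sum>j\<in>I. (cmod (cip T x (\<lambda>k. H k j + unit_fun j k)))\<^sup>2)
        = real N * Re (cip T x (\<lambda>i. x i + kernel_app H T x i))"
begin

lemma finite_sub: "T \<subseteq> I \<Longrightarrow> finite T"
  using finI by (rule finite_subset[rotated])

lemma cnorm_column_le:
  assumes "T \<subseteq> I" "j \<in> I"
  shows "(cnorm T (\<lambda>i. H i j))\<^sup>2 \<le> real (card T) / real N"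
proof -
  have "(cnorm T (\<lambda>i. H i j))\<^sup>2 \<le> (\<Sum>i\<in>T. 1 / real N)"
    unfolding cnorm_sq using assms by (intro sum_mono coherence) auto
  then show ?thesis by simp
qed

text \<open>Entry \<open>i\<close> of H_T^q b_j is the inner product of H_T^q e_i with b_j, so
  summing over \<open>j\<close> first brings in the frame identity. Its cross term <x, H_T x> would
  give an odd trace; the arithmetic-geometric mean inequality trades it for two even ones.\<close>

lemma frame_sum_le:
  assumes T: "T \<subseteq> I"
  shows "(\<Sum>j\<in>I - T. (cnorm T (pw T q (\<lambda>i. H i j)))\<^sup>2)
    \<le> real N * (3 / 2 * even_trace T q + 1 / 2 * even_trace T (Suc q))"
proof -
  define x where "x i = pw T q (unit_fun i)" for i
  have entry: "pw T q (\<lambda>i. H i j) i = cip T (x i) (\<lambda>k. H k j + unit_fun j k)" if "i \<in> T" "j \<notin> T" for i j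
  proof -
    have "pw T q (\<lambda>i. H i j) i = cip T (x i) (\<lambda>k. H k j)"
      by (simp add: x_def cip_pw[symmetric] cip_unit finite_sub T that)
    \<comment> \<open>The added \<open>unit_fun j\<close> vanishes on \<open>T\<close>, since
      \<open>j\<close> lies outside.\<close>
    also have "\<dots> = cip T (x i) (\<lambda>k. H k j + unit_fun j k)"
      unfolding cip_def using that by (intro sum.cong) (auto simp: unit_fun_def)
    finally show ?thesis .
  qed
  have "(\<Sum>j\<in>I - T. (cnorm T (pw T q (\<lambda>i. H i j)))\<^sup>2)
      = (\<Sum>j\<in>I - T. \<Sum>i\<in>T. (cmod (cip T (x i) (\<lambda>k. H k j + unit_fun j k)))\<^sup>2)"
    unfolding cnorm_sq by (intro sum.cong refl) (auto simp: entry)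
  \<comment> \<open>Including the terms with \<open>j\<close> in \<open>T\<close> only increases the
    sum and completes the frame sum.\<close>
  also have "\<dots> \<le> (\<Sum>j\<in>I. \<Sum>i\<in>T. (cmod (cip T (x i) (\<lambda>k. H k j + unit_fun j k)))\<^sup>2)"
    using finI by (intro sum_mono2 sum_nonneg) auto
  also have "\<dots> = (\<Sum>i\<in>T. real N * Re (cip T (x i) (\<lambda>k. x i k + kernel_app H T (x i) k)))"
    by (subst sum.swap) (simp add: frame T)
  also have "\<dots> \<le> (\<Sum>i\<in>T. real N * (3 / 2 * (cnorm T (x i))\<^sup>2 + 1 / 2 * (cnorm T (kernel_app H T (x i)))\<^sup>2))"
  proof (intro sum_mono mult_left_mono)
    fix i
    have "Re (cip T (x i) (kernel_app H T (x i))) \<le> cnorm T (x i) * cnorm T (kernel_app H T (x i))"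
      by (rule order_trans[OF complex_Re_le_cmod cip_cauchy_schwarz])
    also have "\<dots> \<le> ((cnorm T (x i))\<^sup>2 + (cnorm T (kernel_app H T (x i)))\<^sup>2) / 2"
      using sum_squares_bound[of "cnorm T (x i)" "cnorm T (kernel_app H T (x i))"] by simp
    finally show "Re (cip T (x i) (\<lambda>k. x i k + kernel_app H T (x i) k))
      \<le> 3 / 2 * (cnorm T (x i))\<^sup>2 + 1 / 2 * (cnorm T (kernel_app H T (x i)))\<^sup>2"
      by (simp add: cip_add_right cip_self add_divide_distrib)
  qed simp
  also have "\<dots> = real N * (3 / 2 * even_trace T q + 1 / 2 * even_trace T (Suc q))"
    by (simp add: even_trace_def x_def sum_distrib_left sum.distrib distrib_left sum_divide_distrib)
  finally show ?thesis .
qed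

definition subsets :: "nat \<Rightarrow> 'i set set" where
  "subsets k = {T. T \<subseteq> I \<and> card T = k}"

lemma finite_subsets: "finite (subsets k)"
  using finI by (simp add: subsets_def)

lemma even_trace_0: "finite T \<Longrightarrow> even_trace T 0 = real (card T)"
proof -
  assume T: "finite T"
  have "(cnorm T (unit_fun j))\<^sup>2 = 1" if "j \<in> T" for j
    unfolding cnorm_sq unit_fun_def using T that
    by (subst sum.remove[of _ j]) (auto intro!: sum.neutral)
  then show ?thesis by (simp add: even_trace_def)
qed

text \<open>By coherence the squared column norms are at most k/N, hence at most \<open>L\<close>.
  The order \<open>Suc q\<close> reappears on the right, but for smaller sets, so the recursion runs
  over the size of the set.\<close>

lemma sum_even_trace_Suc:
  assumes "real k \<le> L * real N" "L \<ge> 0"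
  shows "(\<Sum>T\<in>subsets (Suc k). even_trace T (Suc q))
    \<le> 3 * real N * (3 / 2 * (\<Sum>T\<in>subsets k. even_trace T q) + 1 / 2 * (\<Sum>T\<in>subsets k. even_trace T (Suc q)))
      + real (card (subsets k)) * (real (card I - k) * (L * (8 * real q * L) ^ q))"
proof -
  let ?F = "\<lambda>T j. 3 * (cnorm T (pw T q (\<lambda>i. H i j)))\<^sup>2 + L * (8 * real q * L) ^ q"
  have "even_trace T (Suc q) \<le> (\<Sum>j\<in>T. ?F (T - {j}) j)" if T: "T \<in> subsets (Suc k)" for T
    unfolding even_trace_def
  proof (rule sum_mono)
    fix j assume j: "j \<in> T"
    define a where "a = (cnorm (T - {j}) (\<lambda>i. H i j))\<^sup>2"
    have "a \<le> real (card (T - {j})) / real N"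
      unfolding a_def using T j by (intro cnorm_column_le) (auto simp: subsets_def)
    also have "card (T - {j}) = k" using T j finite_sub[of T] by (simp add: subsets_def)
    also have "real k / real N \<le> L" using assms N_pos by (simp add: field_simps)
    finally have a: "a \<le> L" .
    have a0: "0 \<le> a" by (simp add: a_def)
    have "(cnorm (insert j (T - {j})) (pw (insert j (T - {j})) (Suc q) (unit_fun j)))\<^sup>2
      \<le> 3 * (cnorm (T - {j}) (pw (T - {j}) q (\<lambda>i. H i j)))\<^sup>2 + a * (8 * real q * a) ^ q"
      unfolding a_def using T finite_sub[of T] by (intro cnorm_pw_insert) (auto simp: subsets_def)
    also have "a * (8 * real q * a) ^ q \<le> L * (8 * real q * L) ^ q"
      using a a0 by (intro mult_mono power_mono mult_left_mono) auto
    finally show "(cnorm T (pw T (Suc q) (unit_fun j)))\<^sup>2 \<le> ?F (T - {j}) j"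
      using j by (simp add: insert_absorb)
  qed
  then have "(\<Sum>T\<in>subsets (Suc k). even_trace T (Suc q)) \<le> (\<Sum>T\<in>subsets (Suc k). \<Sum>j\<in>T. ?F (T - {j}) j)"
    by (rule sum_mono)
  also have "\<dots> = (\<Sum>T\<in>subsets k. \<Sum>j\<in>I - T. ?F T j)"
    unfolding subsets_def by (rule sum_subsets_remove[OF finI])
  also have "\<dots> \<le> (\<Sum>T\<in>subsets k. 3 * (real N * (3 / 2 * even_trace T q + 1 / 2 * even_trace T (Suc q)))
      + real (card I - k) * (L * (8 * real q * L) ^ q))"
  proof (rule sum_mono)
    fix T assume T: "T \<in> subsets k"
    have "card (I - T) = card I - k" using T finite_sub[of T] by (simp add: subsets_def card_Diff_subset)
    then have "(\<Sum>j\<in>I - T. ?F T j) = 3 * (\<Sum>j\<in>I - T. (cnorm T (pw T q (\<lambda>i. H i j)))\<^sup>2)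
      + real (card I - k) * (L * (8 * real q * L) ^ q)"
      by (simp add: sum.distrib sum_distrib_left)
    also have "\<dots> \<le> 3 * (real N * (3 / 2 * even_trace T q + 1 / 2 * even_trace T (Suc q)))
      + real (card I - k) * (L * (8 * real q * L) ^ q)"
      using T by (intro add_right_mono mult_left_mono frame_sum_le) (auto simp: subsets_def)
    finally show "(\<Sum>j\<in>I - T. ?F T j) \<le> \<dots>" .
  qed
  also have "\<dots> = 3 * real N * (3 / 2 * (\<Sum>T\<in>subsets k. even_trace T q) + 1 / 2 * (\<Sum>T\<in>subsets k. even_trace T (Suc q)))
      + real (card (subsets k)) * (real (card I - k) * (L * (8 * real q * L) ^ q))"
    by (simp add: sum.distrib sum_distrib_left algebra_simps)
  finally show ?thesis .
qed

text \<open>Induction on the size \<open>k\<close>, for all orders \<open>p \<le> P\<close> at once;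
  \<open>L\<close> and \<open>B\<close> are built from the final \<open>K\<close> and
  \<open>P\<close> so that they stay fixed. The 16 in \<open>B\<close> gives
  \<open>16 * L \<le> B\<close>, which beats the constants of the recursion.\<close>

lemma sum_even_trace_le:
  assumes K: "K > 0" "16 * K \<le> N" and P: "P > 0"
  defines "L \<equiv> real K / real N"
  defines "B \<equiv> 16 * real P * L"
  shows "k \<le> K \<Longrightarrow> p \<le> P \<Longrightarrow>
    (\<Sum>T\<in>subsets k. even_trace T p) \<le> real (card (subsets k)) * real K * B ^ p"
proof (induction k arbitrary: p)
  case 0
  have "subsets 0 = {{}}" using finite_sub by (auto simp: subsets_def)
  then show ?case by (simp add: even_trace_def B_def L_def)
next
  case (Suc k)
  have L0: "0 \<le> L" by (simp add: L_def)
  have L16: "16 * L \<le> 1" using K N_pos by (simp add: L_def field_simps)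
  have LB: "16 * L \<le> B" using mult_right_mono[of 1 "real P" "16 * L"] P L0 by (simp add: B_def)
  have B0: "0 \<le> B" using LB L0 by linarith
  show ?case
  proof (cases p)
    case 0
    have "(\<Sum>T\<in>subsets (Suc k). even_trace T 0) = (\<Sum>T\<in>subsets (Suc k). real (Suc k))"
      using even_trace_0 finite_sub by (intro sum.cong) (auto simp: subsets_def)
    also have "\<dots> \<le> real (card (subsets (Suc k))) * real K"
      using Suc.prems by (simp add: mult_left_mono del: of_nat_Suc)
    finally show ?thesis by (simp add: 0)
  next
    case p: (Suc q)
    define c where "c = real (card (subsets k))"
    define m where "m = real (card I - k)"
    have KL: "real K = L * real N" using N_pos by (simp add: L_def)
    \<comment> \<open>At least half of \<open>I\<close> lies outside a k-set, so N^2 may be replaced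
      by 2m in the recursion.\<close>
    have "2 * k \<le> N\<^sup>2"
    proof -
      have "2 * k \<le> N" using Suc.prems K by linarith
      also have "N \<le> N\<^sup>2" using N_pos by (simp add: power2_eq_square)
      finally show ?thesis .
    qed
    then have "N\<^sup>2 \<le> 2 * (N\<^sup>2 - k)" by linarith
    then have "real (N\<^sup>2) \<le> real (2 * (N\<^sup>2 - k))" by (simp only: of_nat_le_iff)
    then have m: "(real N)\<^sup>2 \<le> 2 * m" by (simp add: m_def cardI)
    have m0: "0 \<le> m" and c0: "0 \<le> c" by (auto simp: m_def c_def)
    \<comment> \<open>Double counting converts the number of k-sets into that of (k+1)-sets; the
      loss \<open>Suc k \<le> K\<close> is the factor \<open>K\<close> in the claim.\<close>
    have "real (Suc k) * real (card (subsets (Suc k))) = c * m"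
      using arg_cong[OF card_subsets_Suc[OF finI, of k], of real]
      unfolding subsets_def c_def m_def of_nat_mult .
    moreover have "real (Suc k) * real (card (subsets (Suc k))) \<le> real K * real (card (subsets (Suc k)))"
      using Suc.prems by (intro mult_right_mono) auto
    ultimately have cK: "c * m \<le> real (card (subsets (Suc k))) * real K" by (simp add: mult.commute)
    have LBq: "L * B ^ q \<le> B ^ Suc q / 16" using mult_right_mono[OF LB, of "B ^ q"] B0 by simp
    have "(\<Sum>T\<in>subsets (Suc k). even_trace T (Suc q))
      \<le> 3 * real N * (3 / 2 * (\<Sum>T\<in>subsets k. even_trace T q) + 1 / 2 * (\<Sum>T\<in>subsets k. even_trace T (Suc q)))
      + c * (m * (L * (8 * real q * L) ^ q))"
      unfolding c_def m_def using Suc.prems L0 N_pos by (intro sum_even_trace_Suc) (auto simp: L_def)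
    also have "\<dots> \<le> 3 * real N * (3 / 2 * (c * real K * B ^ q) + 1 / 2 * (c * real K * B ^ Suc q))
      + c * (m * (L * B ^ q))"
    proof (intro add_mono mult_left_mono)
      show "(\<Sum>T\<in>subsets k. even_trace T q) \<le> c * real K * B ^ q"
        unfolding c_def using Suc.prems p by (intro Suc.IH) auto
      show "(\<Sum>T\<in>subsets k. even_trace T (Suc q)) \<le> c * real K * B ^ Suc q"
        unfolding c_def using Suc.prems p by (intro Suc.IH) auto
      show "(8 * real q * L) ^ q \<le> B ^ q"
      proof (rule power_mono)
        have "8 * real q * L \<le> 16 * real P * L"
          using Suc.prems p L0 by (intro mult_right_mono) auto
        then show "8 * real q * L \<le> B" by (simp add: B_def)
      qed (use L0 in auto)
    qed (use L0 m0 c0 in auto)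
    also have "\<dots> = c * ((3 * (L * B ^ q) * (3 / 2) + 3 / 2 * (L * B ^ Suc q)) * (real N)\<^sup>2 + m * (L * B ^ q))"
      by (simp add: KL algebra_simps power2_eq_square)
    also have "\<dots> \<le> c * ((3 * (L * B ^ q) * (3 / 2) + 3 / 2 * (L * B ^ Suc q)) * (2 * m) + m * (L * B ^ q))"
      using m m0 c0 L0 B0 by (intro mult_left_mono add_mono order_refl) auto
    also have "\<dots> = c * m * (10 * (L * B ^ q) + 3 * (L * B ^ Suc q))"
      by (simp add: algebra_simps)
    also have "\<dots> \<le> c * m * B ^ Suc q"
    proof (rule mult_left_mono)
      \<comment> \<open>Since L is at most B/16 and at most 1/16, the two terms contribute at most
        10/16 and 3/16 of \<open>B ^ Suc q\<close>.\<close>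
      have "16 * L * B ^ Suc q \<le> 1 * B ^ Suc q" using L16 B0 by (intro mult_right_mono) auto
      then show "10 * (L * B ^ q) + 3 * (L * B ^ Suc q) \<le> B ^ Suc q"
        using LBq zero_le_power[OF B0, of "Suc q"] by linarith
    qed (use c0 m0 in auto)
    also have "\<dots> \<le> real (card (subsets (Suc k))) * real K * B ^ Suc q"
      using cK B0 by (intro mult_right_mono) auto
    finally show ?thesis by (simp add: p)
  qed
qed

text \<open>Markov's inequality at the threshold below which the trace forces a contraction;
  dividing by (1/4)^P turns the 16 into 64.\<close>

lemma card_ill_conditioned_le:
  assumes K: "K > 0" "16 * K \<le> N" and P: "P > 0"
  shows "real (card {T \<in> subsets K. even_trace T P \<ge> (1/4) ^ P})
    \<le> real (card (subsets K)) * (real K * (64 * real P * real K / real N) ^ P)"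
proof -
  let ?bad = "{T \<in> subsets K. even_trace T P \<ge> (1/4) ^ P}"
  have "real (card ?bad) * (1/4) ^ P = (\<Sum>T\<in>?bad. (1/4) ^ P)" by simp
  also have "\<dots> \<le> (\<Sum>T\<in>?bad. even_trace T P)" by (rule sum_mono) simp
  also have "\<dots> \<le> (\<Sum>T\<in>subsets K. even_trace T P)"
    using finite_subsets by (intro sum_mono2) (auto simp: even_trace_def intro!: sum_nonneg)
  also have "\<dots> \<le> real (card (subsets K)) * real K * (16 * real P * (real K / real N)) ^ P"
    using sum_even_trace_le[OF K P, of K P] by simp
  finally have le: "real (card ?bad) * (1/4) ^ P * 4 ^ P \<le>
    real (card (subsets K)) * real K * (16 * real P * (real K / real N)) ^ P * 4 ^ P"
    by (rule mult_right_mono) simp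
  have "(1/4 :: real) ^ P * 4 ^ P = 1" by (simp add: power_mult_distrib[symmetric])
  then have "real (card ?bad) * (1/4) ^ P * 4 ^ P = real (card ?bad)" by (simp only: mult.assoc mult_1_right)
  moreover have "(16 * real P * (real K / real N)) ^ P * 4 ^ P = (64 * real P * real K / real N) ^ P"
    unfolding power_mult_distrib[symmetric] by (simp add: mult.assoc)
  ultimately show ?thesis using le by (simp only: mult.assoc)
qed

end

section \<open>Dual certificates\<close>

context hermitian_kernel
begin

definition contractive :: "'i set \<Rightarrow> bool" where
  "contractive T \<longleftrightarrow> (\<forall>v. cnorm T (kernel_app H T v) \<le> cnorm T v / 2)"

lemma cnorm_pw_le_of_contractive:
  "contractive T \<Longrightarrow> cnorm T (pw T s v) \<le> cnorm T v * (1/2) ^ s"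
proof (induction s)
  case (Suc s)
  then show ?case unfolding contractive_def by (auto intro: order_trans)
qed simp

text \<open>The Neumann series, with terms (-1)^s H_T^s b, converges entrywise on \<open>T\<close>
  by comparison with a geometric series.\<close>

lemma contractive_solvable:
  assumes T: "finite T" and C: "contractive T"
  shows "\<exists>x. (\<forall>i\<in>T. x i + kernel_app H T x i = b i)"
proof -
  define f where "f s i = (-1) ^ s * pw T s b i" for s i
  have sm: "summable (\<lambda>s. f s i)" if "i \<in> T" for i
  proof (rule summable_comparison_test')
    show "summable (\<lambda>s. cnorm T b * (1/2) ^ s)" by (intro summable_mult summable_geometric) simp
    show "norm (f s i) \<le> cnorm T b * (1/2) ^ s" for s
      using norm_le_cnorm[OF T that, of "pw T s b"] cnorm_pw_le_of_contractive[OF C, of s b]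
      by (simp add: f_def norm_mult norm_power)
  qed
  define x where "x i = (\<Sum>s. f s i)" for i
  have "x i + kernel_app H T x i = b i" if i: "i \<in> T" for i
  proof -
    have "kernel_app H T x i = (\<Sum>k\<in>T. \<Sum>s. H i k * f s k)"
      unfolding kernel_app_def x_def using sm by (intro sum.cong refl suminf_mult[symmetric]) auto
    also have "\<dots> = (\<Sum>s. \<Sum>k\<in>T. H i k * f s k)"
      using sm by (intro suminf_sum[symmetric] summable_mult)
    \<comment> \<open>Applying H_T to term \<open>s\<close> gives minus term \<open>s + 1\<close>,
      so the image is minus the tail of the series.\<close>
    also have "\<dots> = (\<Sum>s. - f (Suc s) i)"
      by (rule arg_cong[where f = suminf])
        (auto simp: f_def kernel_app_def sum_distrib_left sum_negf[symmetric] mult_ac intro!: ext sum.cong)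
    also have "\<dots> = - (\<Sum>s. f (Suc s) i)"
      using sm[OF i] by (intro suminf_minus iffD2[OF summable_Suc_iff[of "\<lambda>s. f s i"]])
    also have "\<dots> = - (x i - f 0 i)"
      unfolding x_def suminf_split_head[OF sm[OF i]] ..
    finally show ?thesis by (simp add: f_def)
  qed
  then show ?thesis by blast
qed

text \<open>The triangle inequality gives |x| \<le> |b| + |x|/2. The case b = 0 later serves as
  injectivity of 1 + H_T.\<close>

lemma contractive_inverse_bound:
  assumes C: "contractive T" and x: "\<And>i. i \<in> T \<Longrightarrow> x i + kernel_app H T x i = b i"
  shows "cnorm T x \<le> 2 * cnorm T b"
proof -
  have "cnorm T x = cnorm T (\<lambda>i. b i + - kernel_app H T x i)"
    unfolding cnorm_def by (intro L2_set_cong) (auto simp: x[symmetric])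
  also have "\<dots> \<le> cnorm T b + cnorm T (\<lambda>i. - kernel_app H T x i)" by (rule cnorm_le_add)
  also have "\<dots> \<le> cnorm T b + cnorm T x / 2" using C unfolding contractive_def cnorm_uminus by simp
  finally show ?thesis by simp
qed

text \<open>Self-adjointness moves the inverse of 1 + H_T from the sign vector to a fixed column, so
  a certificate entry becomes a linear form in the signs whose coefficients do not depend on
  them.\<close>

lemma cip_solve:
  assumes a: "\<And>i. i \<in> T \<Longrightarrow> a i + kernel_app H T a i = b i"
    and v: "\<And>i. i \<in> T \<Longrightarrow> v i + kernel_app H T v i = \<sigma> i"
  shows "cip T b v = cip T a \<sigma>"
proof -
  have "cip T b v = cip T (\<lambda>i. a i + kernel_app H T a i) v"
    unfolding cip_def by (intro sum.cong) (auto simp: a)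
  also have "\<dots> = cip T a v + cip T (kernel_app H T a) v"
    by (simp add: cip_def distrib_right sum.distrib)
  also have "\<dots> = cip T a (\<lambda>i. v i + kernel_app H T v i)"
    by (simp add: cip_app cip_add_right)
  also have "\<dots> = cip T a \<sigma>"
    unfolding cip_def by (intro sum.cong) (auto simp: v)
  finally show ?thesis .
qed

text \<open>For finite contractive \<open>T\<close> this is (1 + H_T)^(-1) b_j on \<open>T\<close>.
  It is chosen from \<open>T\<close> and \<open>j\<close> alone, hence constant once the support is
  fixed, as Hoeffding's inequality requires.\<close>

definition dual_coeff :: "'i set \<Rightarrow> 'i \<Rightarrow> 'i \<Rightarrow> complex" where
  "dual_coeff T j = (SOME x. \<forall>i\<in>T. x i + kernel_app H T x i = H i j)"

lemma dual_coeff: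
  assumes "finite T" "contractive T" "i \<in> T"
  shows "dual_coeff T j i + kernel_app H T (dual_coeff T j) i = H i j"
  using someI_ex[OF contractive_solvable[OF assms(1,2), of "\<lambda>i. H i j"]] assms(3)
  unfolding dual_coeff_def by blast

lemma cnorm_dual_coeff:
  assumes "finite T" "contractive T"
  shows "cnorm T (dual_coeff T j) \<le> 2 * cnorm T (\<lambda>i. H i j)"
  using dual_coeff[OF assms] by (intro contractive_inverse_bound assms)

end

section \<open>Gram matrices of dictionaries with unit-norm columns\<close>

definition gram :: "'a set \<Rightarrow> ('i \<Rightarrow> 'a \<Rightarrow> complex) \<Rightarrow> 'i \<Rightarrow> 'i \<Rightarrow> complex" where
  "gram A \<phi> i j = cip A (\<phi> i) (\<phi> j) - unit_fun j i"

locale unit_dictionary =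
  fixes A :: "'a set" and \<phi> :: "'i \<Rightarrow> 'a \<Rightarrow> complex"
  assumes unit_norm: "\<And>i. cnorm A (\<phi> i) = 1"
begin

sublocale hermitian_kernel "gram A \<phi>"
proof
  show "gram A \<phi> j i = cnj (gram A \<phi> i j)" for i j
    using cip_cnj[of A "\<phi> j" "\<phi> i"] by (simp add: gram_def unit_fun_def)
  show "gram A \<phi> i i = 0" for i
    by (simp add: gram_def cip_self unit_norm unit_fun_def)
qed

lemma cip_columns: "cip A (\<phi> i) (\<phi> j) = gram A \<phi> i j + unit_fun j i"
  by (simp add: gram_def)

lemma cip_synthesis:
  assumes "finite T"
  shows "cip A (\<phi> j) (\<lambda>a. \<Sum>k\<in>T. v k * \<phi> k a) = (if j \<in> T then v j else 0) + kernel_app (gram A \<phi>) T v j"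
proof -
  have "cip A (\<phi> j) (\<lambda>a. \<Sum>k\<in>T. v k * \<phi> k a) = (\<Sum>a\<in>A. \<Sum>k\<in>T. v k * (cnj (\<phi> j a) * \<phi> k a))"
    by (simp add: cip_def sum_distrib_left mult_ac)
  also have "\<dots> = (\<Sum>k\<in>T. v k * cip A (\<phi> j) (\<phi> k))"
    by (subst sum.swap) (simp add: cip_def sum_distrib_left)
  also have "\<dots> = (\<Sum>k\<in>T. v k * unit_fun k j) + kernel_app (gram A \<phi>) T v j"
    by (simp add: cip_columns kernel_app_def distrib_left sum.distrib mult.commute)
  also have "(\<Sum>k\<in>T. v k * unit_fun k j) = (if j \<in> T then v j else 0)"
    using assms by (simp add: unit_fun_def if_distrib[of "\<lambda>x. _ * x"] cong: if_cong)
  finally show ?thesis .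
qed

text \<open>The certificate \<open>u\<close> lists the correlations of the columns with
  \<open>h\<close>, a combination of the columns in \<open>T\<close> chosen so that \<open>u\<close>
  equals the signs there. As \<open>u\<close> is orthogonal to the kernel, |s|_1 = Re <u, s + d>
  \<le> |s + d|_1, and \<open>le\<close> forces equality in every entry.\<close>

lemma l1_unique_of_dual_certificate:
  assumes I: "finite I" "T \<subseteq> I" and C: "contractive T"
    and supp: "\<And>j. j \<notin> T \<Longrightarrow> s j = 0"
    and cert: "\<And>j. j \<in> I - T \<Longrightarrow> cmod (cip T (dual_coeff T j) (\<lambda>i. sgn (s i))) < 1"
    and ker: "\<And>a. a \<in> A \<Longrightarrow> (\<Sum>j\<in>I. d j * \<phi> j a) = 0"
    and le: "(\<Sum>j\<in>I. cmod (s j + d j)) \<le> (\<Sum>j\<in>I. cmod (s j))"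
    and j: "j \<in> I"
  shows "d j = 0"
proof -
  have T: "finite T" using I by (rule finite_subset[rotated])
  obtain v where v: "\<And>i. i \<in> T \<Longrightarrow> v i + kernel_app (gram A \<phi>) T v i = sgn (s i)"
    using contractive_solvable[OF T C, of "\<lambda>i. sgn (s i)"] by blast
  define h where "h a = (\<Sum>k\<in>T. v k * \<phi> k a)" for a
  define u where "u j = cip A (\<phi> j) h" for j
  have uT: "u j = sgn (s j)" if "j \<in> T" for j
    unfolding u_def h_def cip_synthesis[OF T] using that v by simp
  have uI: "cmod (u j) < 1" if "j \<in> I - T" for j
  proof -
    have "u j = cip T (\<lambda>i. gram A \<phi> i j) v"
      unfolding u_def h_def cip_synthesis[OF T] using that
      by (simp add: kernel_app_def cip_def herm[symmetric])
    also have "\<dots> = cip T (dual_coeff T j) (\<lambda>i. sgn (s i))"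
      by (rule cip_solve) (auto simp: dual_coeff T C v)
    finally show ?thesis using cert that by simp
  qed
  have u1: "cmod (u j) \<le> 1" if "j \<in> I" for j
    using uT[of j] uI[of j] that by (cases "j \<in> T") (auto simp: norm_sgn)
  have ortho: "(\<Sum>j\<in>I. cnj (u j) * d j) = 0"
  proof -
    have "(\<Sum>j\<in>I. cnj (u j) * d j) = (\<Sum>j\<in>I. \<Sum>a\<in>A. cnj (h a) * (d j * \<phi> j a))"
      unfolding u_def cip_def by (simp add: sum_distrib_right sum_distrib_left mult_ac)
    also have "\<dots> = (\<Sum>a\<in>A. cnj (h a) * (\<Sum>j\<in>I. d j * \<phi> j a))"
      by (subst sum.swap) (simp add: sum_distrib_left)
    finally show ?thesis by (simp add: ker)
  qed
  \<comment> \<open>An index of \<open>T\<close> with \<open>s j = 0\<close> causes no trouble,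
    since \<open>sgn 0 = 0\<close>.\<close>
  have us: "Re (cnj (u j) * s j) = cmod (s j)" if "j \<in> I" for j
  proof (cases "j \<in> T")
    case True
    have "cnj (sgn (s j)) * s j = of_real (cmod (s j))"
      by (cases "s j = 0") (auto simp: sgn_eq complex_norm_square[symmetric] power2_eq_square mult.commute)
    then show ?thesis using uT True by simp
  qed (simp add: supp)
  have lower: "Re (cnj (u j) * (s j + d j)) \<le> cmod (s j + d j)" if "j \<in> I" for j
  proof -
    have "Re (cnj (u j) * (s j + d j)) \<le> cmod (u j) * cmod (s j + d j)"
      using complex_Re_le_cmod[of "cnj (u j) * (s j + d j)"] by (simp add: norm_mult)
    also have "\<dots> \<le> 1 * cmod (s j + d j)" using u1[OF that] by (intro mult_right_mono) auto
    finally show ?thesis by simp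
  qed
  have "(\<Sum>j\<in>I. Re (cnj (u j) * (s j + d j))) = (\<Sum>j\<in>I. Re (cnj (u j) * s j)) + Re (\<Sum>j\<in>I. cnj (u j) * d j)"
    unfolding Re_sum by (simp add: distrib_left sum.distrib del: complex_cnj_mult)
  also have "\<dots> = (\<Sum>j\<in>I. cmod (s j))" using us by (simp add: ortho)
  finally have "(\<Sum>j\<in>I. cmod (s j + d j) - Re (cnj (u j) * (s j + d j))) \<le> 0"
    using le by (simp add: sum_subtractf)
  moreover have "(\<Sum>j\<in>I. cmod (s j + d j) - Re (cnj (u j) * (s j + d j))) \<ge> 0"
    using lower by (intro sum_nonneg) auto
  ultimately have "\<forall>j\<in>I. cmod (s j + d j) - Re (cnj (u j) * (s j + d j)) = 0"
    using lower I(1) by (subst sum_nonneg_eq_0_iff[symmetric]) (auto intro: antisym)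
  then have eq: "cmod (s j + d j) = Re (cnj (u j) * (s j + d j))" if "j \<in> I" for j using that by auto
  \<comment> \<open>Off \<open>T\<close>, equality makes |d_j| the real part of a product of modulus
    |u_j| |d_j|, and |u_j| < 1 leaves only d_j = 0.\<close>
  have off: "d j = 0" if j: "j \<in> I - T" for j
  proof (rule ccontr)
    assume "d j \<noteq> 0"
    have "cmod (d j) = Re (cnj (u j) * d j)" using eq[of j] j supp[of j] by simp
    also have "\<dots> \<le> cmod (u j) * cmod (d j)"
      using complex_Re_le_cmod[of "cnj (u j) * d j"] by (simp add: norm_mult)
    also have "\<dots> < 1 * cmod (d j)" using uI[OF j] \<open>d j \<noteq> 0\<close> by (intro mult_strict_right_mono) auto
    finally show False by simp
  qed
  \<comment> \<open>Now \<open>d\<close> lives on \<open>T\<close>, so correlating its zero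
    synthesis with the columns in \<open>T\<close> gives (1 + H_T) d = 0.\<close>
  have "d i + kernel_app (gram A \<phi>) T d i = 0" if "i \<in> T" for i
  proof -
    have "d i + kernel_app (gram A \<phi>) T d i = cip A (\<phi> i) (\<lambda>a. \<Sum>k\<in>T. d k * \<phi> k a)"
      using that by (simp add: cip_synthesis[OF T])
    also have "\<dots> = cip A (\<phi> i) (\<lambda>a. \<Sum>k\<in>I. d k * \<phi> k a)"
      using I off by (intro arg_cong[of _ _ "cip A (\<phi> i)"] ext sum.mono_neutral_left) auto
    also have "\<dots> = 0" by (simp add: cip_def ker)
    finally show ?thesis .
  qed
  then have "cnorm T d \<le> 2 * cnorm T (\<lambda>_. 0)" by (rule contractive_inverse_bound[OF C])
  then have "cnorm T d = 0" using cnorm_nonneg[of T d] by (simp add: cnorm_def L2_set_def)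
  then have "d j = 0" if "j \<in> T" for j using norm_le_cnorm[OF T that, of d] by simp
  then show ?thesis using off j by blast
qed

end

section \<open>The Alltop dictionary\<close>

definition root_char :: "nat \<Rightarrow> int \<Rightarrow> complex" where
  "root_char N k = cis (2 * pi * of_int k / of_nat N)"

lemma root_char_add: "root_char N (k + l) = root_char N k * root_char N l"
  by (simp add: root_char_def cis_mult distrib_left add_divide_distrib)

lemma root_char_0 [simp]: "root_char N 0 = 1"
  by (simp add: root_char_def)

lemma root_char_uminus: "root_char N (- k) = cnj (root_char N k)"
  by (simp add: root_char_def cis_cnj)

lemma norm_root_char [simp]: "cmod (root_char N k) = 1"
  by (simp add: root_char_def)

lemma root_char_power: "root_char N k ^ m = root_char N (int m * k)"
  unfolding root_char_def Complex.DeMoivre by (simp add: mult_ac)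

lemma root_char_eq_1_iff:
  assumes "N > 0"
  shows "root_char N k = 1 \<longleftrightarrow> int N dvd k"
proof
  assume "root_char N k = 1"
  then obtain m :: int where "2 * pi * of_int k / of_nat N = 2 * of_int m * pi"
    unfolding root_char_def cis.code complex_eq_iff
    using cos_one_2pi_int[of "2 * pi * of_int k / of_nat N"] by auto
  then have "real_of_int k = real_of_int (m * int N)" using assms by (simp add: field_simps)
  then have "k = m * int N" by (simp only: of_int_eq_iff)
  then show "int N dvd k" by simp
next
  assume "int N dvd k"
  then obtain m where "k = int N * m" by blast
  have "root_char N k = cis (2 * pi * of_int m)" unfolding root_char_def
    using assms \<open>k = int N * m\<close> by (intro arg_cong[of _ _ cis]) simp
  also have "\<dots> = 1" by (rule cis_multiple_2pi) simp
  finally show "root_char N k = 1" .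
qed

lemma root_char_cong:
  assumes "N > 0" "int N dvd k - l"
  shows "root_char N k = root_char N l"
  using root_char_add[of N "k - l" l] root_char_eq_1_iff[OF assms(1), of "k - l"] assms(2) by simp

lemma sum_root_char:
  assumes "N > 0"
  shows "(\<Sum>a<N. root_char N (k * int a)) = (if int N dvd k then of_nat N else 0)"
proof -
  have *: "(\<Sum>a<N. root_char N (k * int a)) = (\<Sum>a<N. root_char N k ^ a)"
    by (simp add: root_char_power mult.commute)
  show ?thesis
  proof (cases "int N dvd k")
    case True
    then show ?thesis using root_char_eq_1_iff[OF assms, of k] unfolding * by simp
  next
    case False
    then have "root_char N k \<noteq> 1" using root_char_eq_1_iff[OF assms] by simp
    moreover have "root_char N k ^ N = 1"
      unfolding root_char_power root_char_eq_1_iff[OF assms] by simp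
    ultimately show ?thesis using False unfolding * by (simp add: geometric_sum)
  qed
qed

text \<open>Shifting by one drops the first term of a period and appends an equal one. This
  justifies the substitution a = d + b in a Gauss sum without reducing indices.\<close>

lemma sum_periodic_shift:
  fixes g :: "int \<Rightarrow> complex"
  assumes "\<And>x. g (x + int N) = g x"
  shows "(\<Sum>a<N. g (int a + int b)) = (\<Sum>a<N. g (int a))"
proof (induction b)
  case (Suc b)
  define h where "h a = g (int a + int b)" for a
  have "h N = h 0" using assms[of "int b"] by (simp add: h_def add.commute)
  have "(\<Sum>a<N. h (Suc a)) + h 0 = (\<Sum>a<N. h a) + h N"
    using sum.lessThan_Suc_shift[of h N] sum.lessThan_Suc[of h N] by (simp add: add.commute)
  then have "(\<Sum>a<N. h (Suc a)) = (\<Sum>a<N. h a)" using \<open>h N = h 0\<close> by simp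
  then show ?case using Suc by (simp add: h_def algebra_simps)
qed simp

text \<open>In the expansion of |S|^2 put a = d + b. The phase becomes linear in b with slope 2
  alpha d, so the sum over b vanishes unless the prime \<open>N\<close> divides d.\<close>

lemma norm_quadratic_gauss_sum:
  fixes \<alpha> \<beta> \<gamma> :: int
  assumes p: "prime N" and \<alpha>: "\<not> int N dvd 2 * \<alpha>"
  shows "(cmod (\<Sum>a<N. root_char N (\<alpha> * (int a)\<^sup>2 + \<beta> * int a + \<gamma>)))\<^sup>2 = real N"
proof -
  have N: "N > 0" using p by (simp add: prime_gt_0_nat)
  define q where "q x = \<alpha> * x\<^sup>2 + \<beta> * x + \<gamma>" for x
  define S where "S = (\<Sum>a<N. root_char N (q (int a)))"
  have "complex_of_real ((cmod S)\<^sup>2) = S * cnj S" by (rule complex_norm_square)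
  also have "\<dots> = (\<Sum>b<N. (\<Sum>a<N. root_char N (q (int a) - q (int b))))"
    unfolding S_def cnj_sum sum_product
    by (subst sum.swap) (simp add: root_char_uminus[symmetric] root_char_add[symmetric])
  also have "\<dots> = (\<Sum>b<N. (\<Sum>d<N. root_char N (q (int d + int b) - q (int b))))"
  proof (rule sum.cong[OF refl])
    fix b :: nat
    have "root_char N (q (x + int N) - q (int b)) = root_char N (q x - q (int b))" for x
    proof (rule root_char_cong[OF N])
      have "q (x + int N) - q (int b) - (q x - q (int b)) = int N * (\<alpha> * (2 * x + int N) + \<beta>)"
        by (simp add: q_def algebra_simps power2_eq_square)
      then show "int N dvd q (x + int N) - q (int b) - (q x - q (int b))" by simp
    qed
    then show "(\<Sum>a<N. root_char N (q (int a) - q (int b))) = (\<Sum>d<N. root_char N (q (int d + int b) - q (int b)))"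
      by (rule sum_periodic_shift[symmetric, of "\<lambda>x. root_char N (q x - q (int b))"])
  qed
  also have "\<dots> = (\<Sum>b<N. \<Sum>d<N. root_char N (\<alpha> * (int d)\<^sup>2 + \<beta> * int d) * root_char N (2 * \<alpha> * int d * int b))"
    unfolding root_char_add[symmetric]
    by (intro sum.cong refl arg_cong[of _ _ "root_char N"]) (simp add: q_def algebra_simps power2_eq_square)
  also have "\<dots> = (\<Sum>d<N. root_char N (\<alpha> * (int d)\<^sup>2 + \<beta> * int d) * (if int N dvd 2 * \<alpha> * int d then of_nat N else 0))"
    by (subst sum.swap) (simp add: sum_distrib_left[symmetric] sum_root_char[OF N])
  also have "\<dots> = (\<Sum>d<N. if d = 0 then of_nat N else 0)"
  proof (intro sum.cong refl)
    fix d assume d: "d \<in> {..<N}"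
    have "int N dvd 2 * \<alpha> * int d \<longleftrightarrow> int N dvd int d"
      using p \<alpha> by (subst prime_dvd_mult_iff) auto
    also have "\<dots> \<longleftrightarrow> d = 0" using d by (auto dest: dvd_imp_le)
    finally show "root_char N (\<alpha> * (int d)\<^sup>2 + \<beta> * int d) * (if int N dvd 2 * \<alpha> * int d then of_nat N else 0)
      = (if d = 0 then of_nat N else 0)" by simp
  qed
  also have "\<dots> = of_nat N" using N by simp
  finally have "complex_of_real ((cmod S)\<^sup>2) = complex_of_real (real N)" by simp
  then show ?thesis unfolding S_def q_def of_real_eq_iff .
qed

section \<open>Coherence and tightness of the Alltop dictionary\<close>

text \<open>The closed form of H_i f, as \<open>tf_shift_alltop\<close> confirms, with shift
  \<open>i div N\<close> and modulation \<open>i mod N\<close>. The integer difference may be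
  negative; reducing it modulo \<open>N\<close> does not change the character.\<close>

definition alltop_column :: "nat \<Rightarrow> nat \<Rightarrow> nat \<Rightarrow> complex" where
  "alltop_column N i a
    = root_char N (int (i mod N) * int a + (int a - int (i div N)) ^ 3) / of_real (sqrt (real N))"

lemma cip_alltop_column:
  "cip {..<N} (alltop_column N i) (alltop_column N j)
    = (\<Sum>a<N. root_char N ((int (j mod N) - int (i mod N)) * int a
        + ((int a - int (j div N)) ^ 3 - (int a - int (i div N)) ^ 3))) / of_nat N"
proof -
  have "complex_of_real (sqrt (real N)) * of_real (sqrt (real N)) = of_nat N"
    by (simp flip: of_real_mult)
  then show ?thesis
    unfolding cip_def alltop_column_def sum_divide_distrib
    by (intro sum.cong refl) (simp add: root_char_uminus[symmetric] root_char_add[symmetric] algebra_simps)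
qed

lemma unit_dictionary_alltop: "N > 0 \<Longrightarrow> unit_dictionary {..<N} (alltop_column N)"
  by unfold_locales (simp add: cnorm_def L2_set_def alltop_column_def norm_divide power_divide)

text \<open>Cubes with different shifts differ by a quadratic polynomial, which leads to a Gauss sum
  of modulus sqrt N. Equal shifts leave the full sum of a nontrivial character, which is
  zero.\<close>

lemma coherence_alltop:
  assumes p: "prime N" and N5: "N \<ge> 5" and i: "i < N\<^sup>2" and j: "j < N\<^sup>2" and ij: "i \<noteq> j"
  shows "(cmod (cip {..<N} (alltop_column N i) (alltop_column N j)))\<^sup>2 \<le> 1 / real N"
proof -
  have N: "N > 0" using N5 by simp
  define k l r t where "k = int (i mod N)" "l = int (j mod N)" "r = int (i div N)" "t = int (j div N)"
  note defs = this
  have bnd: "0 \<le> r" "r < int N" "0 \<le> t" "t < int N" "0 \<le> k" "k < int N" "0 \<le> l" "l < int N"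
    using i j N by (auto simp: defs less_mult_imp_div_less power2_eq_square)
  show ?thesis
  proof (cases "r = t")
    case True
    have "k \<noteq> l"
      using True ij unfolding defs by (metis div_mod_decomp of_nat_eq_iff)
    have "\<not> int N dvd l - k"
    proof
      assume "int N dvd l - k"
      then have "\<bar>int N\<bar> \<le> \<bar>l - k\<bar>" using \<open>k \<noteq> l\<close> by (intro dvd_imp_le_int) auto
      then show False using bnd by linarith
    qed
    then show ?thesis
      using True unfolding cip_alltop_column defs(1,2,3,4)[symmetric] by (simp add: sum_root_char[OF N])
  next
    case False
    have cube: "(l - k) * x + ((x - t) ^ 3 - (x - r) ^ 3)
      = 3 * (r - t) * x\<^sup>2 + (3 * (t\<^sup>2 - r\<^sup>2) + (l - k)) * x + (r ^ 3 - t ^ 3)" for x :: int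
      by (simp add: algebra_simps power2_eq_square power3_eq_cube)
    \<comment> \<open>Twice the leading coefficient is 6(r - t): \<open>N \<ge> 5\<close> rules out
      the factors 2 and 3, and |r - t| < N the last one.\<close>
    have "\<not> int N dvd 2 * (3 * (r - t))"
    proof
      assume "int N dvd 2 * (3 * (r - t))"
      then have "int N dvd 2 \<or> int N dvd 3 \<or> int N dvd r - t"
        using p by (metis prime_dvd_mult_iff prime_nat_int_transfer)
      moreover have "\<bar>int N\<bar> \<le> \<bar>r - t\<bar>" if "int N dvd r - t"
        using that False by (intro dvd_imp_le_int) auto
      ultimately show False using bnd N5 zdvd_imp_le[of "int N" 2] zdvd_imp_le[of "int N" 3] by auto
    qed
    from norm_quadratic_gauss_sum[OF p this] show ?thesis
      unfolding cip_alltop_column defs(1,2,3,4)[symmetric] cube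
      by (simp add: norm_divide power_divide) (simp add: power2_eq_square)
  qed
qed

lemma sum_mod_div:
  fixes f :: "nat \<Rightarrow> nat \<Rightarrow> complex"
  assumes N: "N > 0"
  shows "(\<Sum>i<N\<^sup>2. f (i mod N) (i div N)) = (\<Sum>r<N. \<Sum>k<N. f k r)"
proof -
  have "(\<Sum>i<N * N. f (i mod N) (i div N)) = (\<Sum>r<N. \<Sum>i = r * N..<r * N + N. f (i mod N) (i div N))"
    by (rule sum.nat_group[symmetric])
  also have "\<dots> = (\<Sum>r<N. \<Sum>k<N. f k r)"
  proof (rule sum.cong[OF refl])
    fix r
    have "(\<Sum>i = r * N..<r * N + N. f (i mod N) (i div N)) = (\<Sum>k = 0..<N. f ((k + r * N) mod N) ((k + r * N) div N))"
      using sum.shift_bounds_nat_ivl[of "\<lambda>i. f (i mod N) (i div N)" 0 "r * N" N] by (simp add: add.commute)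
    then show "(\<Sum>i = r * N..<r * N + N. f (i mod N) (i div N)) = (\<Sum>k<N. f k r)"
      using N by (simp add: lessThan_atLeast0)
  qed
  finally show ?thesis by (simp add: power2_eq_square)
qed

text \<open>Summing over the modulations enforces a = b; there the cubic phases cancel and each of
  the \<open>N\<close> shifts contributes 1.\<close>

lemma alltop_column_dual:
  assumes N: "N > 0" and ab: "a < N" "b < N"
  shows "(\<Sum>i<N\<^sup>2. alltop_column N i a * cnj (alltop_column N i b)) = (if a = b then of_nat N else 0)"
proof -
  let ?g = "\<lambda>r. root_char N ((int a - int r) ^ 3 - (int b - int r) ^ 3)"
  have dvd: "int N dvd int a - int b \<longleftrightarrow> a = b"
  proof
    assume *: "int N dvd int a - int b"
    show "a = b"
    proof (rule ccontr)
      assume "a \<noteq> b"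
      then have "\<bar>int N\<bar> \<le> \<bar>int a - int b\<bar>" using * by (intro dvd_imp_le_int) auto
      then show False using ab by linarith
    qed
  qed simp
  have sq: "complex_of_real (sqrt (real N)) * of_real (sqrt (real N)) = of_nat N"
    by (simp flip: of_real_mult)
  have "(\<Sum>i<N\<^sup>2. alltop_column N i a * cnj (alltop_column N i b))
    = (\<Sum>i<N\<^sup>2. root_char N ((int a - int b) * int (i mod N)) * ?g (i div N) / of_nat N)"
    unfolding alltop_column_def using sq
    by (intro sum.cong refl) (simp add: root_char_uminus[symmetric] root_char_add[symmetric] algebra_simps)
  also have "\<dots> = (\<Sum>r<N. \<Sum>k<N. root_char N ((int a - int b) * int k) * ?g r / of_nat N)"
    by (rule sum_mod_div[OF N])
  also have "\<dots> = (\<Sum>r<N. (if a = b then of_nat N else 0) * ?g r / of_nat N)"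
    unfolding sum_distrib_right[symmetric] sum_divide_distrib[symmetric] sum_root_char[OF N] dvd ..
  also have "\<dots> = (if a = b then of_nat N else 0)" using N by simp
  finally show ?thesis .
qed

lemma tight_frame_alltop:
  assumes N: "N > 0"
  shows "(\<Sum>i<N\<^sup>2. (cmod (cip {..<N} y (alltop_column N i)))\<^sup>2) = real N * (cnorm {..<N} y)\<^sup>2"
proof -
  have "complex_of_real (\<Sum>i<N\<^sup>2. (cmod (cip {..<N} y (alltop_column N i)))\<^sup>2)
    = (\<Sum>i<N\<^sup>2. \<Sum>a<N. \<Sum>b<N. cnj (y a) * y b * (alltop_column N i a * cnj (alltop_column N i b)))"
    unfolding of_real_sum complex_norm_square cip_def cnj_sum sum_product by (simp add: mult_ac)
  also have "\<dots> = (\<Sum>a<N. \<Sum>b<N. \<Sum>i<N\<^sup>2. cnj (y a) * y b * (alltop_column N i a * cnj (alltop_column N i b)))"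
    by (subst sum.swap, rule sum.cong[OF refl], rule sum.swap)
  also have "\<dots> = (\<Sum>a<N. \<Sum>b<N. cnj (y a) * y b * (if a = b then of_nat N else 0))"
    by (simp add: sum_distrib_left[symmetric] alltop_column_dual[OF N])
  also have "\<dots> = (\<Sum>a<N. cnj (y a) * y a * of_nat N)"
    by (simp add: if_distrib[of "\<lambda>x. _ * x"] cong: if_cong)
  also have "\<dots> = of_nat N * cip {..<N} y y"
    by (simp add: cip_def sum_distrib_left mult_ac)
  also have "\<dots> = complex_of_real (real N * (cnorm {..<N} y)\<^sup>2)" by (simp add: cip_self)
  finally show ?thesis unfolding of_real_eq_iff .
qed

text \<open>With y the synthesis of \<open>x\<close> over \<open>T\<close>, both sides equal c
  |y|^2.\<close>

lemma (in unit_dictionary) gram_frame: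
  assumes T: "finite T"
    and tight: "\<And>y. (\<Sum>j\<in>I. (cmod (cip A y (\<phi> j)))\<^sup>2) = c * (cnorm A y)\<^sup>2"
  shows "(\<Sum>j\<in>I. (cmod (cip T x (\<lambda>k. gram A \<phi> k j + unit_fun j k)))\<^sup>2)
    = c * Re (cip T x (\<lambda>i. x i + kernel_app (gram A \<phi>) T x i))"
proof -
  define y where "y a = (\<Sum>k\<in>T. x k * \<phi> k a)" for a
  have syn: "cip A y z = (\<Sum>k\<in>T. cnj (x k) * cip A (\<phi> k) z)" for z
    unfolding cip_def y_def cnj_sum sum_distrib_right
    by (subst sum.swap) (simp add: sum_distrib_left mult_ac)
  have "cip T x (\<lambda>k. gram A \<phi> k j + unit_fun j k) = cip A y (\<phi> j)" for j
    unfolding syn cip_columns by (simp add: cip_def)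
  then have "(\<Sum>j\<in>I. (cmod (cip T x (\<lambda>k. gram A \<phi> k j + unit_fun j k)))\<^sup>2) = c * (cnorm A y)\<^sup>2"
    by (simp add: tight)
  also have "(cnorm A y)\<^sup>2 = Re (cip A y y)" by (simp add: cip_self)
  also have "cip A y y = cip T x (\<lambda>i. x i + kernel_app (gram A \<phi>) T x i)"
    unfolding syn unfolding y_def[abs_def] cip_synthesis[OF T] unfolding cip_def by (intro sum.cong) auto
  finally show ?thesis .
qed

lemma gram_kernel_alltop:
  assumes p: "prime N" and N5: "N \<ge> 5"
  shows "gram_kernel (gram {..<N} (alltop_column N)) {..<N\<^sup>2} N"
proof -
  have N: "N > 0" using N5 by simp
  interpret unit_dictionary "{..<N}" "alltop_column N" by (rule unit_dictionary_alltop[OF N])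
  show ?thesis
  proof unfold_locales
    fix i j assume "i \<in> {..<N\<^sup>2}" "j \<in> {..<N\<^sup>2}"
    then show "(cmod (gram {..<N} (alltop_column N) i j))\<^sup>2 \<le> 1 / real N"
      using coherence_alltop[OF p N5, of i j] diag[of i]
      by (cases "i = j") (auto simp: gram_def unit_fun_def)
  next
    fix T :: "nat set" and x assume "T \<subseteq> {..<N\<^sup>2}"
    then have "finite T" by (rule finite_subset) simp
    then show "(\<Sum>j<N\<^sup>2. (cmod (cip T x (\<lambda>k. gram {..<N} (alltop_column N) k j + unit_fun j k)))\<^sup>2)
      = real N * Re (cip T x (\<lambda>i. x i + kernel_app (gram {..<N} (alltop_column N)) T x i))"
      by (rule gram_frame) (rule tight_frame_alltop[OF N])
  qed (use N in auto)
qed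

section \<open>The matrices of the statement in closed form\<close>

lemma root_unity_power: "root_unity N ^ m = root_char N (int m)"
proof -
  have "root_unity N = root_char N 1"
    by (simp add: root_unity_def root_char_def cis_conv_exp mult_ac)
  then show ?thesis by (simp add: root_char_power)
qed

lemma alltop_nth: "n < N \<Longrightarrow> alltop N $ n = root_char N (int n ^ 3) / of_real (sqrt (real N))"
  by (simp add: alltop_def root_char_def cis_conv_exp mult_ac)

lemma shift_mat_simps [simp]:
  "dim_row (shift_mat N) = N" "dim_col (shift_mat N) = N"
  "a < N \<Longrightarrow> b < N \<Longrightarrow> shift_mat N $$ (a, b) = (if a = (b + 1) mod N then 1 else 0)"
  by (simp_all add: shift_mat_def)

lemma shift_mat_power:
  "shift_mat N ^\<^sub>m k = mat N N (\<lambda>(a, b). if a = (b + k) mod N then 1 else 0)"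
proof (induction k)
  case 0
  show ?case by (rule eq_matI) auto
next
  case (Suc k)
  show ?case
  proof (rule eq_matI)
    fix a b assume "a < dim_row (mat N N (\<lambda>(a, b). if a = (b + Suc k) mod N then 1 else (0::complex)))"
      "b < dim_col (mat N N (\<lambda>(a, b). if a = (b + Suc k) mod N then 1 else (0::complex)))"
    then have ab: "a < N" "b < N" by auto
    have "(shift_mat N ^\<^sub>m Suc k) $$ (a, b)
      = (\<Sum>c = 0..<N. (if a = (c + k) mod N then 1 else 0) * (if c = (b + 1) mod N then 1 else 0))"
      using ab by (simp add: Suc.IH scalar_prod_def)
    also have "\<dots> = (if a = ((b + 1) mod N + k) mod N then 1 else 0)"
      using ab by (simp add: if_distrib[of "\<lambda>x. _ * x"] sum.delta cong: if_cong)
    also have "((b + 1) mod N + k) mod N = (b + Suc k) mod N" by (simp add: mod_simps)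
    finally show "(shift_mat N ^\<^sub>m Suc k) $$ (a, b) = mat N N (\<lambda>(a, b). if a = (b + Suc k) mod N then 1 else 0) $$ (a, b)"
      using ab by simp
  qed auto
qed

lemma modulation_mat_power:
  "modulation_mat N ^\<^sub>m k = mat_diag N (\<lambda>a. root_char N (int k * int a))"
proof (induction k)
  case 0
  show ?case by (rule eq_matI) (auto simp: modulation_mat_def mat_diag_def)
next
  case (Suc k)
  have "modulation_mat N ^\<^sub>m Suc k = mat_diag N (\<lambda>a. root_char N (int k * int a)) * mat_diag N (\<lambda>a. root_unity N ^ a)"
    by (simp add: Suc.IH) (simp add: modulation_mat_def)
  also have "\<dots> = mat_diag N (\<lambda>a. root_char N (int (Suc k) * int a))"
    by (subst mat_diag_mult_left[of _ N N])
      (auto intro!: eq_matI simp: mat_diag_def root_unity_power root_char_add distrib_right)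
  finally show ?case .
qed

lemma tf_shift_eq:
  "tf_shift N i = mat N N (\<lambda>(a, b). if a = (b + i div N) mod N then root_char N (int (i mod N) * int a) else 0)"
  unfolding tf_shift_def modulation_mat_power shift_mat_power
  by (subst mat_diag_mult_left[of _ N N]) (auto intro!: eq_matI)

text \<open>Row \<open>a\<close> of the time-frequency shift has a single nonzero entry, in the
  column \<open>b0\<close> that is the residue of a - i div N.\<close>

lemma tf_shift_alltop:
  assumes N: "N > 0" and a: "a < N"
  shows "(\<Sum>b<N. tf_shift N i $$ (a, b) * alltop N $ b) = alltop_column N i a"
proof -
  define b0 where "b0 = nat ((int a - int (i div N)) mod int N)"
  have b0: "int b0 = (int a - int (i div N)) mod int N" using N by (simp add: b0_def)
  have b0N: "b0 < N" using N by (simp add: b0_def nat_less_iff)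
  have iff: "a = (b + i div N) mod N \<longleftrightarrow> b = b0" if "b < N" for b
  proof -
    have "a = (b + i div N) mod N \<longleftrightarrow> int a mod int N = (int b + int (i div N)) mod int N"
      using a by (metis mod_less of_nat_add of_nat_eq_iff of_nat_mod)
    also have "\<dots> \<longleftrightarrow> (int a - int (i div N)) mod int N = int b mod int N"
      by (auto simp: mod_eq_dvd_iff algebra_simps)
    also have "\<dots> \<longleftrightarrow> b = b0" using that b0 by auto
    finally show ?thesis .
  qed
  have "(\<Sum>b<N. tf_shift N i $$ (a, b) * alltop N $ b)
    = (\<Sum>b<N. if b = b0 then root_char N (int (i mod N) * int a) * alltop N $ b else 0)"
    using a iff by (intro sum.cong refl) (auto simp: tf_shift_eq)
  also have "\<dots> = root_char N (int (i mod N) * int a) * alltop N $ b0"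
    using b0N by simp
  also have "alltop N $ b0 = root_char N ((int a - int (i div N)) ^ 3) / of_real (sqrt (real N))"
  proof -
    have "int b0 ^ 3 mod int N = (int a - int (i div N)) ^ 3 mod int N"
      unfolding b0 by (simp add: power_mod)
    then have "root_char N (int b0 ^ 3) = root_char N ((int a - int (i div N)) ^ 3)"
      by (intro root_char_cong[OF N]) (simp add: mod_eq_dvd_iff)
    then show ?thesis by (simp add: alltop_nth b0N)
  qed
  finally show ?thesis by (simp add: alltop_column_def root_char_add)
qed

lemma dim_dictionary [simp]: "dim_row (dictionary N) = N" "dim_col (dictionary N) = N\<^sup>2"
  by (simp_all add: dictionary_def)

lemma dictionary_mult_nth:
  assumes N: "N > 0" and a: "a < N" and x: "x \<in> carrier_vec (N\<^sup>2)"
  shows "(dictionary N *\<^sub>v x) $ a = (\<Sum>i<N\<^sup>2. x $ i * alltop_column N i a)"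
proof -
  have "(dictionary N *\<^sub>v x) $ a = (\<Sum>i = 0..<N\<^sup>2. dictionary N $$ (a, i) * x $ i)"
    using a x by (simp add: scalar_prod_def)
  also have "\<dots> = (\<Sum>i = 0..<N\<^sup>2. x $ i * alltop_column N i a)"
  proof (intro sum.cong refl)
    fix i assume i: "i \<in> {0..<N\<^sup>2}"
    have "dictionary N $$ (a, i) = (tf_shift N i *\<^sub>v alltop N) $ a"
      using a i by (simp add: dictionary_def mat_of_cols_index)
    also have "\<dots> = (\<Sum>b<N. tf_shift N i $$ (a, b) * alltop N $ b)"
      using a by (simp add: tf_shift_eq alltop_def scalar_prod_def lessThan_atLeast0)
    finally show "dictionary N $$ (a, i) * x $ i = x $ i * alltop_column N i a"
      by (simp add: tf_shift_alltop[OF N a])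
  qed
  finally show ?thesis by (simp add: lessThan_atLeast0)
qed

lemma channel_alltop:
  assumes N: "N > 0" and s: "s \<in> carrier_vec (N\<^sup>2)"
  shows "channel N s *\<^sub>v alltop N = dictionary N *\<^sub>v s"
proof (rule eq_vecI)
  fix a assume "a < dim_vec (dictionary N *\<^sub>v s)"
  then have a: "a < N" by simp
  have "(channel N s *\<^sub>v alltop N) $ a = (\<Sum>b<N. (\<Sum>i<N\<^sup>2. s $ i * tf_shift N i $$ (a, b)) * alltop N $ b)"
    using a by (simp add: channel_def alltop_def scalar_prod_def lessThan_atLeast0)
  also have "\<dots> = (\<Sum>i<N\<^sup>2. s $ i * (\<Sum>b<N. tf_shift N i $$ (a, b) * alltop N $ b))"
    unfolding sum_distrib_right by (subst sum.swap) (simp add: sum_distrib_left mult_ac)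
  finally show "(channel N s *\<^sub>v alltop N) $ a = (dictionary N *\<^sub>v s) $ a"
    by (simp add: tf_shift_alltop[OF N a] dictionary_mult_nth[OF N a s])
qed (simp add: channel_def)

section \<open>Uniqueness as a Borel event\<close>

text \<open>Uniqueness of the minimizer in terms of the displacement \<open>d\<close> in the kernel.
  Functions carry the product topology, in which this event is shown to be Borel.\<close>

definition l1_unique :: "'i set \<Rightarrow> 'a set \<Rightarrow> ('i \<Rightarrow> 'a \<Rightarrow> complex) \<Rightarrow> ('i \<Rightarrow> complex) \<Rightarrow> bool" where
  "l1_unique I A \<phi> s \<longleftrightarrow> (\<forall>d. (\<forall>a\<in>A. (\<Sum>j\<in>I. d j * \<phi> j a) = 0) \<longrightarrow>
     (\<Sum>j\<in>I. cmod (s j + d j)) \<le> (\<Sum>j\<in>I. cmod (s j)) \<longrightarrow> (\<forall>j\<in>I. d j = 0))"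

lemma l1_unique_cong:
  assumes "\<And>j. j \<in> I \<Longrightarrow> s j = s' j"
  shows "l1_unique I A \<phi> s \<longleftrightarrow> l1_unique I A \<phi> s'"
  using assms by (simp add: l1_unique_def)

lemma bp_recovers_iff:
  assumes N: "N > 0" and s: "s \<in> carrier_vec (N\<^sup>2)"
  shows "bp_recovers (dictionary N) (dictionary N *\<^sub>v s) s
    \<longleftrightarrow> l1_unique {..<N\<^sup>2} {..<N} (alltop_column N) (\<lambda>i. s $ i)"
proof -
  let ?A = "dictionary N" and ?n = "N\<^sup>2"
  let ?P = "\<lambda>x. x \<in> carrier_vec (dim_col ?A) \<and> ?A *\<^sub>v x = ?A *\<^sub>v s"
  have l1: "l1_norm_vec x = (\<Sum>i<?n. cmod (x $ i))" if "x \<in> carrier_vec ?n" for x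
    using that by (simp add: l1_norm_vec_def)
  have ker: "?A *\<^sub>v x = ?A *\<^sub>v s \<longleftrightarrow> (\<forall>a\<in>{..<N}. (\<Sum>i<?n. (x $ i - s $ i) * alltop_column N i a) = 0)"
    if "x \<in> carrier_vec ?n" for x
  proof -
    have "?A *\<^sub>v x = ?A *\<^sub>v s \<longleftrightarrow> (\<forall>a<N. (?A *\<^sub>v x) $ a = (?A *\<^sub>v s) $ a)"
      by (auto simp del: index_mult_mat_vec intro!: eq_vecI)
    also have "\<dots> \<longleftrightarrow> (\<forall>a<N. (\<Sum>i<?n. (x $ i - s $ i) * alltop_column N i a) = 0)"
      using s that by (simp add: dictionary_mult_nth[OF N] left_diff_distrib sum_subtractf del: index_mult_mat_vec)
    finally show ?thesis by auto
  qed
  have Ps: "?P s" using s by simp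
  have eqI: "x = s" if "x \<in> carrier_vec ?n" "\<forall>j\<in>{..<?n}. x $ j - s $ j = 0" for x
    using that s by (intro eq_vecI) auto
  show ?thesis
  proof
    assume rec: "bp_recovers ?A (?A *\<^sub>v s) s"
    show "l1_unique {..<?n} {..<N} (alltop_column N) (\<lambda>i. s $ i)"
      unfolding l1_unique_def
    proof (intro allI impI ballI)
      fix d j assume d0: "\<forall>a\<in>{..<N}. (\<Sum>j<?n. d j * alltop_column N j a) = 0"
        and le: "(\<Sum>j<?n. cmod (s $ j + d j)) \<le> (\<Sum>j<?n. cmod (s $ j))" and j: "j \<in> {..<?n}"
      define x where "x = vec ?n (\<lambda>i. s $ i + d i)"
      have x: "x \<in> carrier_vec ?n" by (simp add: x_def)
      have Px: "?P x" using x d0 by (simp add: ker[OF x]) (simp add: x_def)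
      have "l1_norm_vec x \<le> l1_norm_vec s" using le by (simp add: l1[OF x] l1[OF s]) (simp add: x_def)
      moreover have "is_arg_min l1_norm_vec ?P s"
        using rec by (auto simp: bp_recovers_def bp_solutions_def)
      \<comment> \<open>A feasible vector of no larger norm than a minimizer is itself a
        minimizer.\<close>
      ultimately have "is_arg_min l1_norm_vec ?P x"
        using Px unfolding is_arg_min_def by (meson order_less_le_trans)
      then have "x = s" using rec by (auto simp: bp_recovers_def bp_solutions_def)
      then have "s $ j + d j = s $ j" using j by (auto simp: x_def dest: arg_cong[of _ _ "\<lambda>v. v $ j"])
      then show "d j = 0" by simp
    qed
  next
    assume uniq: "l1_unique {..<?n} {..<N} (alltop_column N) (\<lambda>i. s $ i)"
    have u: "x = s" if Px: "?P x" and le: "l1_norm_vec x \<le> l1_norm_vec s" for x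
    proof -
      have x: "x \<in> carrier_vec ?n" using Px by simp
      have "\<forall>j\<in>{..<?n}. x $ j - s $ j = 0"
        using uniq[unfolded l1_unique_def, rule_format, of "\<lambda>i. x $ i - s $ i"] Px ker[OF x] le l1[OF x] l1[OF s]
        by auto
      then show ?thesis by (rule eqI[OF x])
    qed
    have "is_arg_min l1_norm_vec ?P s"
      unfolding is_arg_min_def using Ps u by (metis less_imp_le less_irrefl)
    moreover have "x = s" if min: "is_arg_min l1_norm_vec ?P x" for x
    proof (rule u)
      show "?P x" using min by (simp add: is_arg_min_def)
      show "l1_norm_vec x \<le> l1_norm_vec s" using min Ps unfolding is_arg_min_def not_less[symmetric] by blast
    qed
    ultimately show "bp_recovers ?A (?A *\<^sub>v s) s"
      unfolding bp_recovers_def bp_solutions_def by blast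
  qed
qed

text \<open>Compactness yields a convergent subsequence of the witnesses, whose limit is a witness
  for the limit point.\<close>

lemma closed_exists_compact:
  fixes C :: "'b::metric_space set" and R :: "('a::metric_space \<times> 'b) set"
  assumes C: "compact C" and R: "closed R"
  shows "closed {s. \<exists>d\<in>C. (s, d) \<in> R}"
  unfolding closed_sequential_limits
proof (intro allI impI, elim conjE)
  fix x l assume x: "\<forall>n. x n \<in> {s. \<exists>d\<in>C. (s, d) \<in> R}" and lim: "x \<longlonglongrightarrow> l"
  then obtain d where d: "\<And>n. d n \<in> C" "\<And>n. (x n, d n) \<in> R" by simp metis
  obtain l' r where l': "l' \<in> C" "strict_mono r" "(d \<circ> r) \<longlonglongrightarrow> l'"
    using C d(1) unfolding compact_def by blast
  have "(\<lambda>n. (x (r n), d (r n))) \<longlonglongrightarrow> (l, l')"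
    using l'(3) LIMSEQ_subseq_LIMSEQ[OF lim l'(2)] by (intro tendsto_Pair) (auto simp: o_def)
  then have "(l, l') \<in> R" using R d(2) by (rule_tac closed_sequentially) auto
  then show "l \<in> {s. \<exists>d\<in>C. (s, d) \<in> R}" using l'(1) by blast
qed

text \<open>Tychonoff's theorem, carried over to the function type.\<close>

lemma compact_fun_box:
  fixes B :: "'i \<Rightarrow> 'b::topological_space set"
  assumes "\<And>i. compact (B i)"
  shows "compact {d. \<forall>i. d i \<in> B i}"
proof -
  have "compactin (product_topology (\<lambda>_. euclidean) UNIV) (PiE UNIV B)"
    unfolding compactin_PiE using assms by (auto simp: compactin_euclidean_iff)
  then show ?thesis
    by (simp add: euclidean_product_topology compactin_euclidean_iff PiE_UNIV_domain Pi_def)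
qed

text \<open>The complement is a countable union of projections of closed sets along compact sets.\<close>
lemma borel_l1_unique:
  fixes I :: "'i::countable set"
  assumes I: "finite I"
  shows "{s. l1_unique I A \<phi> s} \<in> sets borel"
proof -
  \<comment> \<open>These sets exhaust the nonzero kernel displacements. The lower bound on the norm
    is a closed substitute for \<open>d\<close> being nonzero, and entries outside \<open>I\<close>
    are frozen at 0 for compactness.\<close>
  define C where "C m = {d :: 'i \<Rightarrow> complex. (\<forall>i. d i \<in> (if i \<in> I then cball 0 (real (Suc m)) else {0})) \<and>
    (\<forall>a\<in>A. (\<Sum>j\<in>I. d j * \<phi> j a) = 0) \<and> 1 / real (Suc m) \<le> (\<Sum>j\<in>I. cmod (d j))}" for m
  define R where "R = {(s, d :: 'i \<Rightarrow> complex). (\<Sum>j\<in>I. cmod (s j + d j)) \<le> (\<Sum>j\<in>I. cmod (s j))}"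
  note [continuous_intros] = continuous_on_product_then_coordinatewise
  have C_eq: "C m = {d. \<forall>i. d i \<in> (if i \<in> I then cball 0 (real (Suc m)) else {0})} \<inter>
    ((\<Inter>a\<in>A. {d. (\<Sum>j\<in>I. d j * \<phi> j a) = 0}) \<inter> {d. 1 / real (Suc m) \<le> (\<Sum>j\<in>I. cmod (d j))})" for m
    by (auto simp: C_def)
  have C_closed: "closed ((\<Inter>a\<in>A. {d :: 'i \<Rightarrow> complex. (\<Sum>j\<in>I. d j * \<phi> j a) = 0})
      \<inter> {d. 1 / real (Suc m) \<le> (\<Sum>j\<in>I. cmod (d j))})" for m
    by (intro closed_Int closed_INT ballI closed_Collect_eq closed_Collect_le continuous_intros)
  have C: "compact (C m)" for m
    unfolding C_eq by (intro compact_Int_closed[OF compact_fun_box C_closed]) simp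
  have R: "closed R"
    unfolding R_def case_prod_unfold
    by (intro closed_Collect_le continuous_intros)
  have "- {s. l1_unique I A \<phi> s} = (\<Union>m. {s. \<exists>d\<in>C m. (s, d) \<in> R})"
  proof (intro equalityI subsetI)
    fix s assume "s \<in> - {s. l1_unique I A \<phi> s}"
    then obtain d0 j where d0: "\<forall>a\<in>A. (\<Sum>j\<in>I. d0 j * \<phi> j a) = 0"
      "(\<Sum>j\<in>I. cmod (s j + d0 j)) \<le> (\<Sum>j\<in>I. cmod (s j))" "j \<in> I" "d0 j \<noteq> 0"
      unfolding l1_unique_def by auto
    define d where "d i = (if i \<in> I then d0 i else 0)" for i
    have pos: "0 < (\<Sum>j\<in>I. cmod (d j))"
      using I d0(3,4) by (intro sum_pos2[of I j]) (auto simp: d_def)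
    obtain m1 :: nat where m1: "(\<Sum>j\<in>I. cmod (d j)) < real m1" using reals_Archimedean2 by blast
    obtain m2 :: nat where m2: "1 / (\<Sum>j\<in>I. cmod (d j)) < real m2" using reals_Archimedean2 by blast
    define m where "m = max m1 m2"
    have "1 / (\<Sum>j\<in>I. cmod (d j)) \<le> real (Suc m)" using m2 by (simp add: m_def)
    then have "1 / real (Suc m) \<le> (\<Sum>j\<in>I. cmod (d j))" using pos by (simp add: field_simps)
    moreover have "cmod (d i) \<le> real (Suc m)" if "i \<in> I" for i
    proof -
      have "cmod (d i) \<le> (\<Sum>j\<in>I. cmod (d j))" using I that by (intro member_le_sum) auto
      then show ?thesis using m1 by (simp add: m_def)
    qed
    ultimately have "d \<in> C m" using d0(1) by (auto simp: C_def d_def)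
    moreover have "(s, d) \<in> R" using d0(2) by (simp add: R_def d_def)
    ultimately show "s \<in> (\<Union>m. {s. \<exists>d\<in>C m. (s, d) \<in> R})" by blast
  next
    fix s assume "s \<in> (\<Union>m. {s. \<exists>d\<in>C m. (s, d) \<in> R})"
    then obtain m d where d: "d \<in> C m" "(s, d) \<in> R" by auto
    have "\<not> l1_unique I A \<phi> s"
    proof
      assume "l1_unique I A \<phi> s"
      then have "\<forall>j\<in>I. d j = 0" using d unfolding l1_unique_def C_def R_def by blast
      then have "(\<Sum>j\<in>I. cmod (d j)) = 0" by simp
      moreover have "0 < 1 / real (Suc m)" by simp
      ultimately show False using d(1) unfolding C_def by simp
    qed
    then show "s \<in> - {s. l1_unique I A \<phi> s}" by simp
  qed
  also have "\<dots> \<in> sets borel"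
    using closed_exists_compact[OF C R] by (intro sets.countable_UN) auto
  finally show ?thesis
    by (metis Compl_eq_Diff_UNIV double_complement sets.compl_sets space_borel)
qed

section \<open>Random signs\<close>

lemma prob_space_complex_gaussian: "prob_space complex_gaussian"
proof -
  let ?m = "density lborel (normal_density 0 (sqrt (1/2)))"
  interpret prob_space ?m by (rule prob_space_normal_density) simp
  interpret pair_prob_space ?m ?m ..
  have "(\<lambda>(x, y). Complex x y) \<in> borel_measurable (?m \<Otimes>\<^sub>M ?m)"
    unfolding Complex_eq case_prod_unfold by measurable
  then show ?thesis unfolding complex_gaussian_def by (rule prob_space_distr)
qed

lemma sets_complex_gaussian [measurable_cong, simp]: "sets complex_gaussian = sets borel"
  by (simp add: complex_gaussian_def)

lemma space_complex_gaussian [simp]: "space complex_gaussian = UNIV"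
  by (simp add: complex_gaussian_def)

lemma distr_uminus_normal:
  fixes \<sigma> :: real
  assumes "\<sigma> > 0"
  shows "distr (density lborel (normal_density 0 \<sigma>)) lborel uminus = density lborel (normal_density 0 \<sigma>)"
proof -
  interpret prob_space "density lborel (normal_density 0 \<sigma>)"
    by (rule prob_space_normal_density) fact
  have "distributed (density lborel (normal_density 0 \<sigma>)) lborel (\<lambda>x. x) (normal_density 0 \<sigma>)"
    unfolding distributed_def by (auto simp: distr_id2)
  from normal_density_affine[OF this assms, of "-1" 0] show ?thesis
    by (simp add: distributed_def)
qed

text \<open>Symmetry, inherited from the two real coordinates, is what gives the random signs mean
  zero.\<close>

lemma distr_uminus_complex_gaussian: "distr complex_gaussian borel uminus = complex_gaussian"
proof -
  let ?m = "density lborel (normal_density 0 (sqrt (1/2)))"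
  let ?c = "\<lambda>(x, y). Complex x y"
  interpret prob_space ?m by (rule prob_space_normal_density) simp
  interpret pair_prob_space ?m ?m ..
  have c [measurable]: "?c \<in> borel_measurable (borel \<Otimes>\<^sub>M borel)"
    unfolding Complex_eq case_prod_unfold by measurable
  have sf: "sigma_finite_measure ?m"
    by (rule prob_space_imp_sigma_finite) (simp add: prob_space_normal_density)
  have d: "distr ?m lborel uminus = ?m" by (rule distr_uminus_normal) simp
  have "?m \<Otimes>\<^sub>M ?m = distr ?m lborel uminus \<Otimes>\<^sub>M distr ?m lborel uminus"
    unfolding d ..
  also have "\<dots> = distr (?m \<Otimes>\<^sub>M ?m) (lborel \<Otimes>\<^sub>M lborel) (\<lambda>(x, y). (- x, - y))"
    by (rule pair_measure_distr) (auto simp: d sf)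
  finally have p: "?m \<Otimes>\<^sub>M ?m = distr (?m \<Otimes>\<^sub>M ?m) (lborel \<Otimes>\<^sub>M lborel) (\<lambda>(x, y). (- x, - y))" .
  have "distr complex_gaussian borel uminus = distr (?m \<Otimes>\<^sub>M ?m) borel (uminus \<circ> ?c)"
    unfolding complex_gaussian_def by (rule distr_distr) measurable
  also have "uminus \<circ> ?c = ?c \<circ> (\<lambda>(x, y). (- x, - y))"
    by (auto simp: complex_eq_iff)
  also have "distr (?m \<Otimes>\<^sub>M ?m) borel \<dots>
      = distr (distr (?m \<Otimes>\<^sub>M ?m) (lborel \<Otimes>\<^sub>M lborel) (\<lambda>(x, y). (- x, - y))) borel ?c"
    by (rule distr_distr[symmetric]) measurable
  also have "\<dots> = complex_gaussian" unfolding p[symmetric] complex_gaussian_def ..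
  finally show ?thesis .
qed

lemma integral_odd_complex_gaussian:
  fixes f :: "complex \<Rightarrow> real"
  assumes [measurable]: "f \<in> borel_measurable borel" and odd: "\<And>z. f (- z) = - f z"
  shows "integral\<^sup>L complex_gaussian f = 0"
proof -
  have "integral\<^sup>L complex_gaussian f = integral\<^sup>L (distr complex_gaussian borel uminus) f"
    unfolding distr_uminus_complex_gaussian ..
  also have "\<dots> = (\<integral>z. f (- z) \<partial>complex_gaussian)"
    by (rule integral_distr) measurable
  finally show ?thesis by (simp add: odd)
qed

lemma borel_measurable_sgn_complex [measurable]: "(sgn :: complex \<Rightarrow> complex) \<in> borel_measurable borel"
  unfolding sgn_div_norm[abs_def] by measurable

text \<open>The joint law of the coordinates is the product measure itself, hence the product of its
  marginals.\<close>

lemma indep_vars_PiM_components: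
  assumes "\<And>i. i \<in> I \<Longrightarrow> prob_space (M i)" and I: "I \<noteq> {}"
  shows "prob_space.indep_vars (PiM I M) M (\<lambda>i \<omega>. \<omega> i) I"
proof -
  interpret prob_space "PiM I M" by (rule prob_space_PiM) fact
  have "distr (PiM I M) (PiM I M) (\<lambda>x. \<lambda>i\<in>I. x i) = distr (PiM I M) (PiM I M) (\<lambda>x. x)"
    by (intro distr_cong) (auto simp: space_PiM PiE_def extensional_restrict)
  also have "\<dots> = PiM I M" by (rule distr_id)
  also have "\<dots> = PiM I (\<lambda>i. distr (PiM I M) (M i) (\<lambda>x. x i))"
    using assms by (intro PiM_cong refl distr_PiM_component[symmetric]) auto
  finally show ?thesis
    using I by (subst indep_vars_iff_distr_eq_PiM') auto
qed

definition gaussian_vector :: "nat \<Rightarrow> (nat \<Rightarrow> complex) measure" where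
  "gaussian_vector n = (\<Pi>\<^sub>M i\<in>{..<n}. complex_gaussian)"

lemma prob_space_gaussian_vector: "prob_space (gaussian_vector n)"
  unfolding gaussian_vector_def by (intro prob_space_PiM prob_space_complex_gaussian)

lemma measurable_gaussian_vector_component:
  "i < n \<Longrightarrow> (\<lambda>g. g i) \<in> borel_measurable (gaussian_vector n)"
  unfolding gaussian_vector_def
  using measurable_component_singleton[of i "{..<n}" "\<lambda>_. complex_gaussian"] by simp

text \<open>Hoeffding's inequality: each summand is centred, because \<open>sgn\<close> is odd, and
  lies between -|a_i| and |a_i|.\<close>

lemma Re_sign_tail:
  assumes T: "T \<subseteq> {..<n}" and a: "cnorm T a > 0" and t: "t \<ge> 0"
  shows "measure (gaussian_vector n) {g \<in> space (gaussian_vector n). \<bar>Re (cip T a (\<lambda>i. sgn (g i)))\<bar> \<ge> t}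
    \<le> 2 * exp (- t\<^sup>2 / (2 * (cnorm T a)\<^sup>2))"
proof -
  let ?M = "gaussian_vector n"
  interpret prob_space ?M by (rule prob_space_gaussian_vector)
  have finT: "finite T" using T by (rule finite_subset) simp
  have "T \<noteq> {}" using a by (auto simp: cnorm_def)
  then have n: "{..<n} \<noteq> {}" using T by auto
  define X where "X i g = Re (cnj (a i) * sgn (g i))" for i and g :: "nat \<Rightarrow> complex"
  have "indep_vars (\<lambda>_. complex_gaussian) (\<lambda>i g. g i) {..<n}"
    unfolding gaussian_vector_def by (rule indep_vars_PiM_components[OF prob_space_complex_gaussian n])
  then have "indep_vars (\<lambda>_. complex_gaussian) (\<lambda>i g. g i) T"
    by (rule indep_vars_subset[OF _ T])
  then have "indep_vars (\<lambda>_. borel) (\<lambda>i g. Re (cnj (a i) * sgn (g i))) T"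
    by (rule indep_vars_compose2) measurable
  then have indep: "indep_vars (\<lambda>_. borel) X T" by (simp add: X_def[abs_def])
  have Xb: "\<bar>X i g\<bar> \<le> cmod (a i)" for i g
  proof -
    have "\<bar>X i g\<bar> \<le> cmod (a i) * cmod (sgn (g i))"
      unfolding X_def using abs_Re_le_cmod[of "cnj (a i) * sgn (g i)"] by (simp add: norm_mult)
    also have "\<dots> \<le> cmod (a i) * 1" by (intro mult_left_mono) (auto simp: norm_sgn)
    finally show ?thesis by simp
  qed
  have mean: "expectation (X i) = 0" if "i \<in> T" for i
  proof -
    let ?f = "\<lambda>z. Re (cnj (a i) * sgn z)"
    have i: "i \<in> {..<n}" using that T by auto
    have "expectation (X i) = (\<integral>z. ?f z \<partial>distr ?M complex_gaussian (\<lambda>g. g i))"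
      unfolding X_def gaussian_vector_def
      by (subst integral_distr) (auto intro!: measurable_component_singleton i)
    also have "distr ?M complex_gaussian (\<lambda>g. g i) = complex_gaussian"
      unfolding gaussian_vector_def by (intro distr_PiM_component prob_space_complex_gaussian i)
    also have "(\<integral>z. ?f z \<partial>complex_gaussian) = 0"
    proof (rule integral_odd_complex_gaussian)
      show "?f \<in> borel_measurable borel" by measurable
    qed (simp add: sgn_minus)
    finally show ?thesis .
  qed
  interpret Hoeffding_ineq ?M T X "\<lambda>i. - cmod (a i)" "\<lambda>i. cmod (a i)" "\<Sum>i\<in>T. expectation (X i)"
  proof unfold_locales
    show "AE x in ?M. X i x \<in> {- cmod (a i)..cmod (a i)}" for i
      using Xb by (intro always_eventually) (auto simp: abs_le_iff minus_le_iff)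
  qed (auto intro: finT indep)
  have s: "(\<Sum>i\<in>T. (cmod (a i) - - cmod (a i))\<^sup>2) = 4 * (cnorm T a)\<^sup>2"
    unfolding cnorm_sq sum_distrib_left by (simp add: power_mult_distrib[symmetric])
  have "prob {x \<in> space ?M. \<bar>(\<Sum>i\<in>T. X i x) - (\<Sum>i\<in>T. expectation (X i))\<bar> \<ge> t}
    \<le> 2 * exp (- 2 * t\<^sup>2 / (\<Sum>i\<in>T. (cmod (a i) - - cmod (a i))\<^sup>2))"
    unfolding s using a by (intro Hoeffding_ineq_abs_ge[unfolded s] t) simp
  then show ?thesis
    unfolding s by (simp add: mean X_def cip_def)
qed

text \<open>Modulus at least 1 forces the real or the imaginary part to be at least sqrt(1/2) in
  absolute value. The two two-sided tails give the factor 4, and t^2 = 1/2 gives the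
  exponent.\<close>

lemma sign_tail:
  assumes T: "T \<subseteq> {..<n}" and v: "(cnorm T a)\<^sup>2 \<le> v" "v > 0"
  shows "measure (gaussian_vector n) {g \<in> space (gaussian_vector n). cmod (cip T a (\<lambda>i. sgn (g i))) \<ge> 1}
    \<le> 4 * exp (- 1 / (4 * v))"
proof (cases "cnorm T a > 0")
  case False
  then have "cnorm T a = 0" using cnorm_nonneg[of T a] by linarith
  then have "cmod (cip T a z) \<le> 0" for z using cip_cauchy_schwarz[of T a z] by simp
  then have "{g \<in> space (gaussian_vector n). cmod (cip T a (\<lambda>i. sgn (g i))) \<ge> 1} = {}"
    by (auto simp: not_le intro: le_less_trans)
  then show ?thesis by (simp only: measure_empty) simp
next
  case True
  let ?M = "gaussian_vector n"
  interpret prob_space ?M by (rule prob_space_gaussian_vector)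
  let ?E = "\<lambda>b. {g \<in> space ?M. \<bar>Re (cip T b (\<lambda>i. sgn (g i)))\<bar> \<ge> sqrt (1/2)}"
  \<comment> \<open>As \<open>cip\<close> is conjugate-linear on the left, this factor comes out as
    -i and turns the imaginary part into a real part.\<close>
  define a' where "a' i = \<i> * a i" for i
  have ca': "cnorm T a' = cnorm T a" by (simp add: a'_def cnorm_def norm_mult)
  have Im: "Re (cip T a' z) = Im (cip T a z)" for z
    by (simp add: cip_def a'_def)
  have meas: "?E b \<in> sets ?M" for b
  proof -
    have [measurable]: "i \<in> T \<Longrightarrow> (\<lambda>g. g i) \<in> borel_measurable ?M" for i
      using T by (intro measurable_gaussian_vector_component) auto
    show ?thesis unfolding cip_def by measurable
  qed
  have half: "1/2 \<le> x\<^sup>2 \<Longrightarrow> sqrt (1/2) \<le> \<bar>x\<bar>" for x :: real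
    by (metis real_sqrt_abs real_sqrt_le_iff)
  have bound: "prob (?E b) \<le> 2 * exp (- 1 / (4 * v))" if "cnorm T b = cnorm T a" for b
  proof -
    have "prob (?E b) \<le> 2 * exp (- (sqrt (1/2))\<^sup>2 / (2 * (cnorm T b)\<^sup>2))"
      using that True by (intro Re_sign_tail T) auto
    also have "- (sqrt (1/2))\<^sup>2 / (2 * (cnorm T b)\<^sup>2) = - 1 / (4 * (cnorm T a)\<^sup>2)"
      unfolding that by simp
    also have "\<dots> \<le> - 1 / (4 * v)" using v True by (simp add: field_simps)
    finally show ?thesis by simp
  qed
  have "{g \<in> space ?M. cmod (cip T a (\<lambda>i. sgn (g i))) \<ge> 1} \<subseteq> ?E a \<union> ?E a'"
  proof
    fix g assume g: "g \<in> {g \<in> space ?M. cmod (cip T a (\<lambda>i. sgn (g i))) \<ge> 1}"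
    let ?z = "cip T a (\<lambda>i. sgn (g i))"
    have "1 \<le> (cmod ?z)\<^sup>2" using g by (simp add: one_le_power)
    then have "1/2 \<le> (Re ?z)\<^sup>2 \<or> 1/2 \<le> (Im ?z)\<^sup>2" by (simp add: cmod_power2) linarith
    then show "g \<in> ?E a \<union> ?E a'" using g half[of "Re ?z"] half[of "Im ?z"] by (auto simp: Im)
  qed
  then have "prob {g \<in> space ?M. cmod (cip T a (\<lambda>i. sgn (g i))) \<ge> 1} \<le> prob (?E a \<union> ?E a')"
    using meas by (intro finite_measure_mono) auto
  also have "\<dots> \<le> prob (?E a) + prob (?E a')" by (rule measure_Un_le[OF meas meas])
  also have "\<dots> \<le> 2 * exp (- 1 / (4 * v)) + 2 * exp (- 1 / (4 * v))"
    by (intro add_mono bound ca' refl)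
  finally show ?thesis by simp
qed

section \<open>Recovery probability\<close>

definition alltop_unique :: "nat \<Rightarrow> nat set \<Rightarrow> (nat \<Rightarrow> complex) \<Rightarrow> bool" where
  "alltop_unique N T g
    \<longleftrightarrow> l1_unique {..<N\<^sup>2} {..<N} (alltop_column N) (\<lambda>i. if i \<in> T then g i else 0)"

lemma measurable_alltop_unique:
  assumes T: "T \<subseteq> {..<N\<^sup>2}"
  shows "{g \<in> space (gaussian_vector (N\<^sup>2)). alltop_unique N T g} \<in> sets (gaussian_vector (N\<^sup>2))"
proof -
  let ?f = "\<lambda>(g :: nat \<Rightarrow> complex) i. if i \<in> T then g i else 0"
  have "?f \<in> borel_measurable (gaussian_vector (N\<^sup>2))"
  proof (rule measurable_coordinatewise_then_product)
    show "(\<lambda>g. ?f g i) \<in> borel_measurable (gaussian_vector (N\<^sup>2))" for i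
      using T measurable_gaussian_vector_component[of i "N\<^sup>2"] by (cases "i \<in> T") auto
  qed
  from measurable_sets[OF this borel_l1_unique[of "{..<N\<^sup>2}" "{..<N}" "alltop_column N"]] show ?thesis
    by (simp add: alltop_unique_def vimage_def Int_def conj_commute)
qed

text \<open>A union bound over the at most N^2 indices off the support. Coherence and the bound on
  the inverse give each coefficient vector squared norm at most 4K/N, whence the exponent
  N/(16K).\<close>

lemma prob_failure_of_contractive:
  assumes p: "prime N" and N5: "N \<ge> 5" and T: "T \<subseteq> {..<N\<^sup>2}" "card T = K" and K: "K > 0"
    and C: "hermitian_kernel.contractive (gram {..<N} (alltop_column N)) T"
  shows "measure (gaussian_vector (N\<^sup>2)) {g \<in> space (gaussian_vector (N\<^sup>2)). \<not> alltop_unique N T g}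
    \<le> 4 * (real N)\<^sup>2 * exp (- (real N / (16 * real K)))"
proof -
  let ?n = "N\<^sup>2" and ?M = "gaussian_vector (N\<^sup>2)"
  have N: "N > 0" using N5 by simp
  have finT: "finite T" using T(1) by (rule finite_subset) simp
  interpret unit_dictionary "{..<N}" "alltop_column N" by (rule unit_dictionary_alltop[OF N])
  interpret gram_kernel "gram {..<N} (alltop_column N)" "{..<?n}" N by (rule gram_kernel_alltop[OF p N5])
  interpret prob_space ?M by (rule prob_space_gaussian_vector)
  define F where "F j = {g \<in> space ?M. cmod (cip T (dual_coeff T j) (\<lambda>i. sgn (g i))) \<ge> 1}" for j
  have F_meas: "F j \<in> sets ?M" for j
  proof -
    have [measurable]: "i \<in> T \<Longrightarrow> (\<lambda>g. g i) \<in> borel_measurable ?M" for i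
      using T by (intro measurable_gaussian_vector_component) auto
    show ?thesis unfolding F_def cip_def by measurable
  qed
  have F_le: "prob (F j) \<le> 4 * exp (- (real N / (16 * real K)))" if j: "j \<in> {..<?n}" for j
  proof -
    have "(cnorm T (dual_coeff T j))\<^sup>2 \<le> (2 * cnorm T (\<lambda>i. gram {..<N} (alltop_column N) i j))\<^sup>2"
      by (intro power_mono cnorm_dual_coeff finT C) simp
    also have "\<dots> = 4 * (cnorm T (\<lambda>i. gram {..<N} (alltop_column N) i j))\<^sup>2"
      by (simp add: power_mult_distrib)
    also have "\<dots> \<le> 4 * (real K / real N)"
      using cnorm_column_le[OF T(1) j] T(2) by simp
    finally have v: "(cnorm T (dual_coeff T j))\<^sup>2 \<le> 4 * (real K / real N)" .
    have "prob (F j) \<le> 4 * exp (- 1 / (4 * (4 * (real K / real N))))"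
      unfolding F_def using N K by (intro sign_tail T(1) v) simp
    also have "- 1 / (4 * (4 * (real K / real N))) = - (real N / (16 * real K))" by simp
    finally show ?thesis .
  qed
  have "{g \<in> space ?M. \<not> alltop_unique N T g} \<subseteq> (\<Union>j\<in>{..<?n} - T. F j)"
  proof
    fix g assume g: "g \<in> {g \<in> space ?M. \<not> alltop_unique N T g}"
    show "g \<in> (\<Union>j\<in>{..<?n} - T. F j)"
    proof (rule ccontr)
      assume no: "g \<notin> (\<Union>j\<in>{..<?n} - T. F j)"
      let ?s = "\<lambda>i. if i \<in> T then g i else 0"
      have cert: "cmod (cip T (dual_coeff T j) (\<lambda>i. sgn (?s i))) < 1" if "j \<in> {..<?n} - T" for j
      proof -
        have "cip T (dual_coeff T j) (\<lambda>i. sgn (?s i)) = cip T (dual_coeff T j) (\<lambda>i. sgn (g i))"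
          unfolding cip_def by (intro sum.cong) auto
        then show ?thesis using no g that by (auto simp: F_def not_le)
      qed
      have "alltop_unique N T g"
        unfolding alltop_unique_def l1_unique_def
      proof (intro allI impI ballI)
        fix d j assume "\<forall>a\<in>{..<N}. (\<Sum>j<?n. d j * alltop_column N j a) = 0"
          "(\<Sum>j<?n. cmod (?s j + d j)) \<le> (\<Sum>j<?n. cmod (?s j))" "j \<in> {..<?n}"
        then show "d j = 0"
          using cert by (intro l1_unique_of_dual_certificate[of "{..<?n}" T ?s d j] T(1) C) auto
      qed
      then show False using g by simp
    qed
  qed
  then have "prob {g \<in> space ?M. \<not> alltop_unique N T g} \<le> prob (\<Union>j\<in>{..<?n} - T. F j)"
    using F_meas by (intro finite_measure_mono) auto
  also have "\<dots> \<le> (\<Sum>j\<in>{..<?n} - T. prob (F j))"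
    using F_meas by (intro finite_measure_subadditive_finite) auto
  also have "\<dots> \<le> (\<Sum>j\<in>{..<?n}. prob (F j))"
    by (intro sum_mono2) auto
  also have "\<dots> \<le> (\<Sum>j\<in>{..<?n}. 4 * exp (- (real N / (16 * real K))))"
    by (intro sum_mono F_le)
  also have "\<dots> = 4 * (real N)\<^sup>2 * exp (- (real N / (16 * real K)))" by simp
  finally show ?thesis .
qed

lemma prob_space_sparse_space: "prob_space (sparse_space n K)"
proof -
  interpret G: prob_space "gaussian_vector n" by (rule prob_space_gaussian_vector)
  interpret P: pair_prob_space "measure_pmf (pmf_of_set {T. T \<subseteq> {..<n} \<and> card T = K})" "gaussian_vector n"
    by unfold_locales
  show ?thesis unfolding sparse_space_def gaussian_vector_def[symmetric] by (rule P.prob_space_axioms)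
qed

text \<open>The first factor of the space consists of all sets of naturals; dependence on the trace
  on \<open>{..<n}\<close> alone makes the event a finite union of measurable rectangles.\<close>

lemma sparse_event_measurable:
  assumes Q: "\<And>S. S \<subseteq> {..<n} \<Longrightarrow> {g \<in> space (gaussian_vector n). Q S g} \<in> sets (gaussian_vector n)"
    and dep: "\<And>T g. Q T g \<longleftrightarrow> Q (T \<inter> {..<n}) g"
  shows "{\<omega> \<in> space (sparse_space n K). Q (fst \<omega>) (snd \<omega>)} \<in> sets (sparse_space n K)"
proof -
  have "{\<omega> \<in> space (sparse_space n K). Q (fst \<omega>) (snd \<omega>)}
    = (\<Union>S\<in>Pow {..<n}. {T. T \<inter> {..<n} = S} \<times> {g \<in> space (gaussian_vector n). Q S g})"
    using dep unfolding sparse_space_def gaussian_vector_def[symmetric] space_pair_measure by auto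
  also have "\<dots> \<in> sets (sparse_space n K)"
    unfolding sparse_space_def gaussian_vector_def[symmetric]
    by (intro sets.finite_UN pair_measureI Q) auto
  finally show ?thesis .
qed

lemma measure_sparse_space:
  assumes B: "{\<omega> \<in> space (sparse_space n K). Q (fst \<omega>) (snd \<omega>)} \<in> sets (sparse_space n K)"
    and K: "K \<le> n"
  shows "measure (sparse_space n K) {\<omega> \<in> space (sparse_space n K). Q (fst \<omega>) (snd \<omega>)}
    = (\<Sum>T | T \<subseteq> {..<n} \<and> card T = K. measure (gaussian_vector n) {g \<in> space (gaussian_vector n). Q T g})
      / real (card {T. T \<subseteq> {..<n} \<and> card T = K})"
proof -
  let ?S = "{T. T \<subseteq> {..<n} \<and> card T = K}"
  let ?B = "{\<omega> \<in> space (sparse_space n K). Q (fst \<omega>) (snd \<omega>)}"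
  let ?m = "\<lambda>T. measure (gaussian_vector n) {g \<in> space (gaussian_vector n). Q T g}"
  interpret G: prob_space "gaussian_vector n" by (rule prob_space_gaussian_vector)
  interpret S: prob_space "sparse_space n K" by (rule prob_space_sparse_space)
  have fin: "finite ?S" by simp
  have ne: "?S \<noteq> {}" using obtain_subset_with_card_n[of K "{..<n}"] K by auto
  then have card: "card ?S > 0" using fin by (simp add: card_gt_0_iff)
  have slice: "Pair T -` ?B = {g \<in> space (gaussian_vector n). Q T g}" for T
    by (auto simp: sparse_space_def gaussian_vector_def[symmetric] space_pair_measure)
  have "ennreal (measure (sparse_space n K) ?B) = emeasure (sparse_space n K) ?B"
    by (simp add: S.emeasure_eq_measure)
  also have "\<dots> = (\<integral>\<^sup>+ T. emeasure (gaussian_vector n) (Pair T -` ?B) \<partial>measure_pmf (pmf_of_set ?S))"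
    using B unfolding sparse_space_def gaussian_vector_def[symmetric] by (rule G.emeasure_pair_measure_alt)
  also have "\<dots> = (\<Sum>T\<in>?S. ennreal (?m T)) / of_nat (card ?S)"
    unfolding slice G.emeasure_eq_measure using nn_integral_pmf_of_set[OF ne fin] by simp
  also have "\<dots> = ennreal ((\<Sum>T\<in>?S. ?m T) / real (card ?S))"
    using card by (simp add: divide_ennreal[symmetric] sum_nonneg ennreal_of_nat_eq_real_of_nat)
  finally show ?thesis
    by (subst (asm) ennreal_inj) (auto intro!: divide_nonneg_nonneg sum_nonneg)
qed

text \<open>Supports with a large even trace are rare and are charged probability 1; every other
  support is contractive, so the certificate bound applies.\<close>

lemma prob_failure_le:
  assumes p: "prime N" and N5: "N \<ge> 5" and K: "K > 0" "16 * K \<le> N" and P: "P > 0"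
  shows "measure (sparse_space (N\<^sup>2) K)
      {\<omega> \<in> space (sparse_space (N\<^sup>2) K). \<not> alltop_unique N (fst \<omega>) (snd \<omega>)}
    \<le> real K * (64 * real P * real K / real N) ^ P + 4 * (real N)\<^sup>2 * exp (- (real N / (16 * real K)))"
proof -
  let ?n = "N\<^sup>2" and ?M = "gaussian_vector (N\<^sup>2)" and ?H = "gram {..<N} (alltop_column N)"
  let ?m = "\<lambda>T. measure ?M {g \<in> space ?M. \<not> alltop_unique N T g}"
  let ?S = "{T. T \<subseteq> {..<?n} \<and> card T = K}"
  define \<delta> where "\<delta> = 4 * (real N)\<^sup>2 * exp (- (real N / (16 * real K)))"
  define \<beta> where "\<beta> = real K * (64 * real P * real K / real N) ^ P"
  interpret gram_kernel ?H "{..<?n}" N by (rule gram_kernel_alltop[OF p N5])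
  interpret G: prob_space ?M by (rule prob_space_gaussian_vector)
  let ?bad = "{T \<in> subsets K. even_trace T P \<ge> (1/4) ^ P}"
  have Kn: "K \<le> ?n"
  proof -
    have "K \<le> N" using K by linarith
    also have "N \<le> ?n" by (simp add: power2_eq_square)
    finally show ?thesis .
  qed
  have S: "?S = subsets K" by (simp add: subsets_def)
  have meas: "{g \<in> space ?M. \<not> alltop_unique N T g} \<in> sets ?M" if "T \<subseteq> {..<?n}" for T
    using sets.compl_sets[OF measurable_alltop_unique[OF that]]
    by (simp add: set_diff_eq Collect_conj_eq[symmetric] cong: conj_cong)
  have dep: "alltop_unique N T g \<longleftrightarrow> alltop_unique N (T \<inter> {..<?n}) g" for T g
    unfolding alltop_unique_def by (rule l1_unique_cong) auto
  have m: "?m T \<le> (if T \<in> ?bad then 1 else 0) + \<delta>" if T: "T \<in> ?S" for T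
  proof (cases "T \<in> ?bad")
    case True
    have "?m T \<le> 1" by (rule G.prob_le_1)
    moreover have "\<delta> \<ge> 0" by (simp add: \<delta>_def)
    ultimately show ?thesis unfolding if_P[OF True] by linarith
  next
    case False
    then have "even_trace T P < (1/4) ^ P" using T by (auto simp: S)
    then have "contractive T"
      using contraction_of_even_trace[OF finite_sub] T P unfolding contractive_def by auto
    then have "?m T \<le> \<delta>"
      unfolding \<delta>_def using T by (intro prob_failure_of_contractive p N5 K(1)) auto
    then show ?thesis using False by auto
  qed
  have card: "card ?S > 0"
    using obtain_subset_with_card_n[of K "{..<?n}"] Kn by (auto simp: card_gt_0_iff)
  have "measure (sparse_space ?n K) {\<omega> \<in> space (sparse_space ?n K). \<not> alltop_unique N (fst \<omega>) (snd \<omega>)}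
    = (\<Sum>T\<in>?S. ?m T) / real (card ?S)"
    using dep by (intro measure_sparse_space[OF _ Kn] sparse_event_measurable meas) auto
  also have "\<dots> \<le> (\<Sum>T\<in>?S. (if T \<in> ?bad then 1 else 0) + \<delta>) / real (card ?S)"
    by (intro divide_right_mono sum_mono m) auto
  also have "(\<Sum>T\<in>?S. (if T \<in> ?bad then 1 else 0) + \<delta>) = real (card ?bad) + real (card ?S) * \<delta>"
  proof -
    have "(\<Sum>T\<in>?S. if T \<in> ?bad then 1 else (0::real)) = real (card ?bad)"
      unfolding S using finite_subsets by (simp add: sum.If_cases Int_def conj_commute cong: conj_cong)
    then show ?thesis by (simp add: sum.distrib)
  qed
  also have "\<dots> \<le> real (card ?S) * \<beta> + real (card ?S) * \<delta>"
    using card_ill_conditioned_le[OF K P] unfolding \<beta>_def S by simp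
  also have "(real (card ?S) * \<beta> + real (card ?S) * \<delta>) / real (card ?S) = \<beta> + \<delta>"
    unfolding distrib_left[symmetric] using card
    by (intro nonzero_mult_div_cancel_left) (metis less_irrefl of_nat_eq_0_iff)
  finally show ?thesis unfolding \<beta>_def \<delta>_def by (simp add: divide_right_mono)
qed

section \<open>Choice of the moment order and the final constants\<close>

lemma prob_failure_lt:
  assumes p: "prime N" and N5: "N \<ge> 5" and K: "K > 0"
    and L: "100 * ln (real N) \<le> L" and KL: "real K \<le> real N / (16 * L)"
  shows "measure (sparse_space (N\<^sup>2) K)
      {\<omega> \<in> space (sparse_space (N\<^sup>2) K). \<not> alltop_unique N (fst \<omega>) (snd \<omega>)} < 1 / real K"
proof -
  \<comment> \<open>With order about 4 log N, a base of at most 1/e yields the power N^(-4).\<close>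
  define P where "P = nat \<lceil>4 * ln (real N)\<rceil>"
  have N: "real N \<ge> 5" using N5 by simp
  have ln1: "ln (real N) \<ge> 1"
  proof -
    have "exp 1 \<le> real N" using exp_le N by linarith
    then show ?thesis using N by (simp add: ln_ge_iff)
  qed
  have P4: "4 * ln (real N) \<le> real P" unfolding P_def by (simp add: real_nat_ceiling_ge)
  have P5: "real P \<le> 5 * ln (real N)"
  proof -
    have "real P = of_int \<lceil>4 * ln (real N)\<rceil>" using ln1 by (simp add: P_def)
    then show ?thesis using ln1 of_int_ceiling_le_add_one[of "4 * ln (real N)"] by linarith
  qed
  have P0: "P > 0" using P4 ln1 by (cases P) auto
  have L1: "L \<ge> 100" using L ln1 by linarith
  have KL': "16 * L * real K \<le> real N" using KL L1 by (simp add: field_simps)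
  have "16 * real K \<le> 16 * L * real K" using L1 K by simp
  then have KN: "16 * real K \<le> real N" using KL' by linarith
  then have KN': "16 * K \<le> N" by linarith
  \<comment> \<open>From P \<le> 5 ln N \<le> L/20 and 16LK \<le> N the base is at most 64/320 =
    1/5.\<close>
  have x: "64 * real P * real K / real N \<le> exp (-1)"
  proof -
    have "64 * real P * real K \<le> 64 * (5 * ln (real N)) * real K"
      using P5 by (intro mult_right_mono mult_left_mono) auto
    also have "\<dots> \<le> 64 * (5 * (L / 100)) * real K"
      using L by (intro mult_right_mono mult_left_mono) auto
    also have "\<dots> = (1/5) * (16 * L * real K)" by simp
    also have "\<dots> \<le> (1/5) * real N" using KL' by (intro mult_left_mono) auto
    finally have "64 * real P * real K / real N \<le> 1/5" using N by (simp add: field_simps)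
    also have "(1/5 :: real) \<le> exp (-1)"
      using exp_le by (simp add: exp_minus field_simps)
    finally show ?thesis .
  qed
  have "(64 * real P * real K / real N) ^ P \<le> exp (-1) ^ P"
    using x by (intro power_mono) auto
  also have "\<dots> = exp (- real P)" unfolding exp_of_nat_mult[symmetric] by simp
  also have "\<dots> \<le> exp (- (4 * ln (real N)))" using P4 by simp
  also have "\<dots> = 1 / real N ^ 4"
    using N exp_of_nat_mult[of 4 "ln (real N)"] by (simp add: exp_minus field_simps)
  finally have "real K * (64 * real P * real K / real N) ^ P \<le> real N * (1 / real N ^ 4)"
    using KN by (intro mult_mono) auto
  also have "\<dots> = 1 / real N ^ 3" using N by (simp add: field_simps power_numeral_reduce)
  finally have first: "real K * (64 * real P * real K / real N) ^ P \<le> 1 / real N ^ 3" .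
  \<comment> \<open>The bound on \<open>L\<close> would give exponent 100; exponent 5 suffices,
    since with the factor N^2 it matches the order N^(-3) of the first term.\<close>
  have "exp (- (real N / (16 * real K))) \<le> exp (- (5 * ln (real N)))"
  proof -
    have "L \<le> real N / (16 * real K)" using KL' K by (simp add: field_simps)
    then show ?thesis using L ln1 by simp
  qed
  also have "\<dots> = 1 / real N ^ 5"
    using N exp_of_nat_mult[of 5 "ln (real N)"] by (simp add: exp_minus field_simps)
  finally have "4 * (real N)\<^sup>2 * exp (- (real N / (16 * real K))) \<le> 4 * (real N)\<^sup>2 * (1 / real N ^ 5)"
    by (intro mult_left_mono) auto
  also have "\<dots> = 4 / real N ^ 3" using N by (simp add: field_simps power_numeral_reduce)
  finally have second: "4 * (real N)\<^sup>2 * exp (- (real N / (16 * real K))) \<le> 4 / real N ^ 3" .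
  have "1 / real N ^ 3 + 4 / real N ^ 3 = 5 / real N ^ 3" by simp
  also have "\<dots> \<le> real N / real N ^ 3" using N by (intro divide_right_mono) auto
  also have "\<dots> = 1 / (real N)\<^sup>2" using N by (simp add: field_simps power_numeral_reduce)
  also have "\<dots> \<le> 1 / real N" using N by (intro divide_left_mono) (auto simp: power2_eq_square)
  also have "\<dots> < 1 / real K" using KN K N by (intro divide_strict_left_mono) auto
  finally show ?thesis
    using prob_failure_le[OF p N5 K KN' P0] first second by linarith
qed

lemma recovery_event_eq:
  assumes N: "N > 0"
  shows "(let s = sparse_vec (N\<^sup>2) \<omega>; y = channel N s *\<^sub>v alltop N in bp_recovers (dictionary N) y s)
    \<longleftrightarrow> alltop_unique N (fst \<omega>) (snd \<omega>)"
proof -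
  have s: "sparse_vec (N\<^sup>2) \<omega> \<in> carrier_vec (N\<^sup>2)" by (simp add: sparse_vec_def case_prod_unfold)
  show ?thesis
    unfolding Let_def channel_alltop[OF N s] bp_recovers_iff[OF N s] alltop_unique_def
    by (rule l1_unique_cong) (simp add: sparse_vec_def case_prod_unfold)
qed

theorem theorem2:
  shows "\<exists>c::real. c > 0 \<and>
    (\<forall>(N::nat) (K::nat) (\<epsilon>::real).
      prime N \<and> N \<ge> 5 \<and> K \<ge> 1 \<and> 0 < \<epsilon> \<and> \<epsilon> < 1 \<and>
      (\<exists>\<theta>::real. \<theta> \<ge> 1 \<and> sqrt (\<theta> * ln (real N) / ln (real N / \<epsilon>)) \<le> c) \<and>
      real K \<le> real N / (16 * ln (real N / \<epsilon>)) \<longrightarrow>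
      (\<exists>\<theta>::real. \<theta> \<ge> 1 \<and> sqrt (\<theta> * ln (real N) / ln (real N / \<epsilon>)) \<le> c \<and>
        \<P>(\<omega> in sparse_space (N\<^sup>2) K.
            let s = sparse_vec (N\<^sup>2) \<omega>; y = channel N s *\<^sub>v alltop N
            in bp_recovers (dictionary N) y s)
          > 1 - 2 * \<epsilon>\<^sup>2 - real K powr (- \<theta>)))"
proof (rule exI[of _ "1/10 :: real"], intro conjI allI impI)
  fix N K :: nat and \<epsilon> :: real
  assume "prime N \<and> N \<ge> 5 \<and> K \<ge> 1 \<and> 0 < \<epsilon> \<and> \<epsilon> < 1 \<and>
      (\<exists>\<theta>::real. \<theta> \<ge> 1 \<and> sqrt (\<theta> * ln (real N) / ln (real N / \<epsilon>)) \<le> 1/10) \<and>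
      real K \<le> real N / (16 * ln (real N / \<epsilon>))"
  then obtain \<theta> where p: "prime N" and N5: "N \<ge> 5" and K: "K \<ge> 1" and \<epsilon>: "0 < \<epsilon>" "\<epsilon> < 1"
    and \<theta>: "\<theta> \<ge> 1" "sqrt (\<theta> * ln (real N) / ln (real N / \<epsilon>)) \<le> 1/10"
    and KL: "real K \<le> real N / (16 * ln (real N / \<epsilon>))" by blast
  define L where "L = ln (real N / \<epsilon>)"
  have N: "N > 0" using N5 by simp
  have Kpos: "K > 0" using K by simp
  have lnN: "ln (real N) > 0" using N5 by simp
  have "real N * 1 < real N / \<epsilon>" using \<epsilon> N by (simp add: field_simps)
  then have L0: "L > 0" using N5 by (simp add: L_def)
  \<comment> \<open>The constraint weakens as theta decreases, so it also holds for theta = 1, the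
    value used in the conclusion.\<close>
  have "ln (real N) / L \<le> \<theta> * ln (real N) / L"
    using \<theta>(1) lnN L0 by (intro divide_right_mono) auto
  from real_sqrt_le_mono[OF this] have sq: "sqrt (ln (real N) / L) \<le> 1/10"
    using \<theta>(2) unfolding L_def by linarith
  have "ln (real N) / L \<le> (1/10)\<^sup>2"
    using sq lnN L0 by (simp add: sqrt_le_D)
  \<comment> \<open>The factor 100 is the inverse square of c = 1/10.\<close>
  then have L: "100 * ln (real N) \<le> L" using L0 by (simp add: field_simps power2_eq_square)
  let ?S = "sparse_space (N\<^sup>2) K"
  interpret prob_space ?S by (rule prob_space_sparse_space)
  let ?good = "{\<omega> \<in> space ?S. alltop_unique N (fst \<omega>) (snd \<omega>)}"
  have dep: "alltop_unique N T g \<longleftrightarrow> alltop_unique N (T \<inter> {..<N\<^sup>2}) g" for T g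
    unfolding alltop_unique_def by (rule l1_unique_cong) auto
  have good: "?good \<in> sets ?S"
    by (rule sparse_event_measurable[where Q = "alltop_unique N"]) (erule measurable_alltop_unique, rule dep)
  have "space ?S - ?good = {\<omega> \<in> space ?S. \<not> alltop_unique N (fst \<omega>) (snd \<omega>)}" by auto
  then have "1 - prob ?good < 1 / real K"
    using prob_compl[OF good] prob_failure_lt[OF p N5 Kpos L KL[folded L_def]] by simp
  moreover have "real K powr (- 1) = 1 / real K" using K by (simp add: powr_minus_divide)
  moreover have "0 < \<epsilon>\<^sup>2" using \<epsilon> by simp
  ultimately have "prob ?good > 1 - 2 * \<epsilon>\<^sup>2 - real K powr (- 1)" by linarith
  then show "\<exists>\<theta>::real. \<theta> \<ge> 1 \<and> sqrt (\<theta> * ln (real N) / ln (real N / \<epsilon>)) \<le> 1/10 \<and>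
        \<P>(\<omega> in ?S. let s = sparse_vec (N\<^sup>2) \<omega>; y = channel N s *\<^sub>v alltop N
            in bp_recovers (dictionary N) y s) > 1 - 2 * \<epsilon>\<^sup>2 - real K powr (- \<theta>)"
    unfolding recovery_event_eq[OF N] using sq unfolding L_def by (intro exI[of _ 1]) simp
qed simp

end
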